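(* Fix $\alpha\in(0,1)$ and let $\rho=\mathrm{ES}^\alpha$ on $L=L^1$. Then for every $\nu\ge0$ the set $\Pi^{\mathrm{ES}^\alpha}_\nu$ of $\mathrm{ES}^\alpha$-optimal portfolios is nonempty, compact and convex. Moreover: (a) the market does not admit strong $\mathrm{ES}^\alpha$-arbitrage if and only if there exists $Z\in\mathcal{M}$ with $\|Z\|_\infty\le 1/\alpha$; (b) the market does not admit $\mathrm{ES}^\alpha$-arbitrage if and only if there exists $Z\in\mathcal{P}$ with $\|Z\|_\infty<1/\alpha$.
   Context: Let $(\Omega,\mathcal{F},\mathbb{P})$ be a probability space and a market: riskless asset $S^0_0=1$, $S^0_1=1+r$, $r>-1$; risky assets $S^1,\dots,S^d$ with constants $S^i_0>0$ and real-valued $\mathcal{F}$-measurable $S^i_1$; returns $R^i:=(S^i_1-S^i_0)/S^i_0$. Standing assumptions: nonredundancy (if $\theta\in\mathbb{R}^{1+d}$ with $\sum_{i=0}^d\theta^iS^i_t=0$ a.s. for $t\in\{0,1\}$ then $\theta=0$), $R^i\in L^1$, $\mathbb{E}[R^i]\ne r$ for some $i$. Excess return of $\pi\in\mathbb{R}^d$: $X_\pi:=\pi\cdot(R-r\mathbf{1})$; $\Pi_\nu:=\{\pi:\mathbb{E}[X_\pi]=\nu\}$. For $X\in L^1$: $\mathrm{VaR}^u(X):=\inf\{m\in\mathbb{R}:\mathbb{P}[m+X<0]\le u\}$ and $\mathrm{ES}^\alpha(X):=\frac1\alpha\int_0^\alpha\mathrm{VaR}^u(X)\,du$. For a risk measure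 $\rho$: $\Pi^\rho_\nu$ is the set of $\pi\in\Pi_\nu$ with $\rho(X_\pi)<\infty$ and $\rho(X_\pi)\le\rho(X_{\pi'})$ for all $\pi'\in\Pi_\nu$. $\pi$ is $\rho$-efficient if $\mathbb{E}[X_\pi]\ge0$ and no $\pi'$ has $\mathbb{E}[X_{\pi'}]\ge\mathbb{E}[X_\pi]$, $\rho(X_{\pi'})\le\rho(X_\pi)$ with one inequality strict; $\rho$-arbitrage means no $\rho$-efficient portfolio exists; strong $\rho$-arbitrage means for every $\pi$ there is $\pi'$ with $\mathbb{E}[X_{\pi'}]>\mathbb{E}[X_\pi]$ and $\rho(X_{\pi'})<\rho(X_\pi)$. $\mathcal{D}:=\{Z\in L^1:Z\ge0,\mathbb{E}[Z]=1\}$, $\mathcal{M}:=\{Z\in\mathcal{D}:\mathbb{E}[Z(R^i-r)]=0\ \forall i\}$, $\mathcal{P}:=\{Z\in\mathcal{M}:Z>0\text{ a.s.}\}$. *)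

theory Defs
  imports "HOL-Probability.Probability"
begin

(* Market: probability space M, interest rate r, initial prices S0 (risky assets
   indexed by a finite type 'd), terminal prices S1. *)

definition ret :: "real^'d \<Rightarrow> ('a \<Rightarrow> real^'d) \<Rightarrow> 'd \<Rightarrow> 'a \<Rightarrow> real" where
  "ret S0 S1 i \<omega> = (S1 \<omega> $ i - S0 $ i) / S0 $ i"

definition excess :: "real \<Rightarrow> real^'d \<Rightarrow> ('a \<Rightarrow> real^'d) \<Rightarrow> real^'d \<Rightarrow> 'a \<Rightarrow> real" where
  "excess r S0 S1 \<pi> \<omega> = (\<Sum>i\<in>UNIV. \<pi> $ i * (ret S0 S1 i \<omega> - r))"

definition market :: "'a measure \<Rightarrow> real \<Rightarrow> real^'d \<Rightarrow> ('a \<Rightarrow> real^'d) \<Rightarrow> bool" where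
  "market M r S0 S1 \<longleftrightarrow>
     prob_space M \<and> r > -1 \<and> (\<forall>i. S0 $ i > 0) \<and>
     (\<forall>i. (\<lambda>\<omega>. S1 \<omega> $ i) \<in> borel_measurable M) \<and>
     \<comment> \<open>nonredundancy\<close>
     (\<forall>(\<theta>0::real) (\<theta>::real^'d).
        (\<theta>0 + (\<Sum>i\<in>UNIV. \<theta> $ i * S0 $ i) = 0 \<and>
         (AE \<omega> in M. \<theta>0 * (1 + r) + (\<Sum>i\<in>UNIV. \<theta> $ i * S1 \<omega> $ i) = 0))
        \<longrightarrow> \<theta>0 = 0 \<and> \<theta> = 0) \<and>
     (\<forall>i. integrable M (ret S0 S1 i)) \<and>
     (\<exists>i. (\<integral>\<omega>. ret S0 S1 i \<omega> \<partial>M) \<noteq> r)"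

definition VaR :: "'a measure \<Rightarrow> real \<Rightarrow> ('a \<Rightarrow> real) \<Rightarrow> real" where
  "VaR M u X = Inf {m. measure M {\<omega>\<in>space M. m + X \<omega> < 0} \<le> u}"

definition ES :: "'a measure \<Rightarrow> real \<Rightarrow> ('a \<Rightarrow> real) \<Rightarrow> real" where
  "ES M \<alpha> X = (LBINT u=0..\<alpha>. VaR M u X) / \<alpha>"

definition Pi_nu :: "'a measure \<Rightarrow> real \<Rightarrow> real^'d \<Rightarrow> ('a \<Rightarrow> real^'d) \<Rightarrow> real \<Rightarrow> (real^'d) set" where
  "Pi_nu M r S0 S1 \<nu> = {\<pi>. (\<integral>\<omega>. excess r S0 S1 \<pi> \<omega> \<partial>M) = \<nu>}"

(* rho-optimal portfolios; rho is real valued here (finite on L^1) *)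
definition Pi_opt :: "'a measure \<Rightarrow> (('a \<Rightarrow> real) \<Rightarrow> real) \<Rightarrow> real \<Rightarrow> real^'d \<Rightarrow> ('a \<Rightarrow> real^'d) \<Rightarrow> real \<Rightarrow> (real^'d) set" where
  "Pi_opt M \<rho> r S0 S1 \<nu> = {\<pi> \<in> Pi_nu M r S0 S1 \<nu>.
      \<forall>\<pi>'\<in>Pi_nu M r S0 S1 \<nu>. \<rho> (excess r S0 S1 \<pi>) \<le> \<rho> (excess r S0 S1 \<pi>')}"

definition efficient :: "'a measure \<Rightarrow> (('a \<Rightarrow> real) \<Rightarrow> real) \<Rightarrow> real \<Rightarrow> real^'d \<Rightarrow> ('a \<Rightarrow> real^'d) \<Rightarrow> real^'d \<Rightarrow> bool" where
  "efficient M \<rho> r S0 S1 \<pi> \<longleftrightarrow>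
     (let E = (\<lambda>p. \<integral>\<omega>. excess r S0 S1 p \<omega> \<partial>M); R = (\<lambda>p. \<rho> (excess r S0 S1 p)) in
      E \<pi> \<ge> 0 \<and>
      \<not> (\<exists>\<pi>'. E \<pi>' \<ge> E \<pi> \<and> R \<pi>' \<le> R \<pi> \<and> (E \<pi>' > E \<pi> \<or> R \<pi>' < R \<pi>)))"

definition rho_arbitrage :: "'a measure \<Rightarrow> (('a \<Rightarrow> real) \<Rightarrow> real) \<Rightarrow> real \<Rightarrow> real^'d \<Rightarrow> ('a \<Rightarrow> real^'d) \<Rightarrow> bool" where
  "rho_arbitrage M \<rho> r S0 S1 \<longleftrightarrow> \<not> (\<exists>\<pi>. efficient M \<rho> r S0 S1 \<pi>)"

definition strong_rho_arbitrage :: "'a measure \<Rightarrow> (('a \<Rightarrow> real) \<Rightarrow> real) \<Rightarrow> real \<Rightarrow> real^'d \<Rightarrow> ('a \<Rightarrow> real^'d) \<Rightarrow> bool" where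
  "strong_rho_arbitrage M \<rho> r S0 S1 \<longleftrightarrow>
     (\<forall>\<pi>. \<exists>\<pi>'. (\<integral>\<omega>. excess r S0 S1 \<pi>' \<omega> \<partial>M) > (\<integral>\<omega>. excess r S0 S1 \<pi> \<omega> \<partial>M) \<and>
              \<rho> (excess r S0 S1 \<pi>') < \<rho> (excess r S0 S1 \<pi>))"

definition densD :: "'a measure \<Rightarrow> ('a \<Rightarrow> real) set" where
  "densD M = {Z. integrable M Z \<and> (AE \<omega> in M. Z \<omega> \<ge> 0) \<and> (\<integral>\<omega>. Z \<omega> \<partial>M) = 1}"

definition densM :: "'a measure \<Rightarrow> real \<Rightarrow> real^'d \<Rightarrow> ('a \<Rightarrow> real^'d) \<Rightarrow> ('a \<Rightarrow> real) set" where
  "densM M r S0 S1 = {Z \<in> densD M. \<forall>i.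
      integrable M (\<lambda>\<omega>. Z \<omega> * (ret S0 S1 i \<omega> - r)) \<and>
      (\<integral>\<omega>. Z \<omega> * (ret S0 S1 i \<omega> - r) \<partial>M) = 0}"

definition densP :: "'a measure \<Rightarrow> real \<Rightarrow> real^'d \<Rightarrow> ('a \<Rightarrow> real^'d) \<Rightarrow> ('a \<Rightarrow> real) set" where
  "densP M r S0 S1 = {Z \<in> densM M r S0 S1. AE \<omega> in M. Z \<omega> > 0}"

definition Linf_norm :: "'a measure \<Rightarrow> ('a \<Rightarrow> real) \<Rightarrow> ereal" where
  "Linf_norm M Z = esssup M (\<lambda>\<omega>. ereal \<bar>Z \<omega>\<bar>)"

end

theory Submission
  imports Defs
begin

text \<open>Since \<open>u \<mapsto> VaR\<^sup>u(X)\<close> has the law of \<open>-X\<close> under Lebesgue measure on \<open>(0,1)\<close>, the expected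
  shortfall equals \<open>min\<^sub>m m + E[(-m-X)\<^sup>+]/\<alpha>\<close>. Hence the risk of a portfolio is sublinear in the
  portfolio, dominates \<open>-E[ZX]\<close> for every density \<open>0 \<le> Z \<le> 1/\<alpha>\<close>, and strictly so for
  \<open>0 < Z < 1/\<alpha>\<close> unless \<open>X\<close> is constant. With \<open>Z = 1\<close> this makes the risk coercive on the
  hyperplane of portfolios with zero mean excess return, so optimal portfolios exist.
  Strong arbitrage amounts to some portfolio having negative risk, arbitrage to some nonzero
  portfolio having nonpositive risk. The pricing densities come from separating \<open>(1,0)\<close> from the
  closed convex set of all \<open>E[Z (1, R - r)]\<close> with \<open>a \<le> Z \<le> b\<close>: the separating vector
  \<open>(m,\<pi>)\<close> makes the minimand above negative (for \<open>[a,b] = [0,1/\<alpha>]\<close>) or arbitrarily small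
  relative to the norm of \<open>(m,\<pi>)\<close> (for \<open>[a,b] = [\<delta>,1/\<alpha>-\<delta>]\<close> with \<open>\<delta>\<close> small).\<close>

section \<open>Quantile transform and the Rockafellar-Uryasev formula\<close>

text \<open>The event \<open>m + X \<omega> < 0\<close> is the complement of
  \<open>- X \<omega> \<le> m\<close>. Value at risk at level \<open>u\<close> is thus the
  \<open>1 - u\<close> quantile of \<open>- X\<close>, to which the theory of
  \<open>cdf_distribution\<close> applies.\<close>

lemma (in prob_space) VaR_conv_cdf:
  assumes [measurable]: "X \<in> borel_measurable M"
  shows "VaR M u X = Inf {x. 1 - u \<le> cdf (distr M borel (\<lambda>\<omega>. - X \<omega>)) x}"
proof -
  have "cdf (distr M borel (\<lambda>\<omega>. - X \<omega>)) m = 1 - prob {\<omega>\<in>space M. m + X \<omega> < 0}" for m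
  proof -
    have "cdf (distr M borel (\<lambda>\<omega>. - X \<omega>)) m = prob {\<omega>\<in>space M. \<not> m + X \<omega> < 0}"
      unfolding cdf_def by (subst measure_distr) (auto intro!: arg_cong[where f = prob])
    also have "\<dots> = 1 - prob {\<omega>\<in>space M. m + X \<omega> < 0}"
      by (rule prob_neg) measurable
    finally show ?thesis .
  qed
  then show ?thesis by (simp add: VaR_def)
qed

lemma (in prob_space) VaR_antimono:
  assumes "X \<in> borel_measurable M" "0 < u" "u \<le> v" "v < 1"
  shows "VaR M v X \<le> VaR M u X"
proof -
  have m: "(\<lambda>\<omega>. - X \<omega>) \<in> borel_measurable M" using assms(1) by simp
  interpret D: cdf_distribution "distr M borel (\<lambda>\<omega>. - X \<omega>)"
    unfolding cdf_distribution_def by (rule real_distribution_distr[OF m])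
  show ?thesis
    unfolding VaR_conv_cdf[OF assms(1)]
    using assms by (intro mono_onD[OF D.mono_I]) auto
qed

text \<open>Inverse transform sampling: on (0,1) the quantile function carries Lebesgue measure to
  the law of \<open>- X\<close>. A general \<open>f\<close> is allowed because both the identity and
  the excess over a threshold are needed.\<close>

lemma (in prob_space) VaR_integral:
  fixes f :: "real \<Rightarrow> real"
  assumes X: "X \<in> borel_measurable M" and f: "f \<in> borel_measurable borel"
    and int: "integrable M (\<lambda>\<omega>. f (- X \<omega>))"
  shows "set_integrable lborel {0<..<1} (\<lambda>u. f (VaR M u X))"
    and "(LINT u:{0<..<1}|lborel. f (VaR M u X)) = expectation (\<lambda>\<omega>. f (- X \<omega>))"
proof -
  define N where "N = distr M borel (\<lambda>\<omega>. - X \<omega>)"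
  have m: "(\<lambda>\<omega>. - X \<omega>) \<in> borel_measurable M" using X by simp
  interpret D: cdf_distribution N
    unfolding cdf_distribution_def N_def by (rule real_distribution_distr[OF m])
  let ?U = "restrict_space lborel {0<..<1::real}"
  let ?I = "\<lambda>u. Inf {x. u \<le> cdf N x}"
  have I: "?I \<in> measurable ?U borel"
    using D.measurable_CI by (simp add: measurable_def space_restrict_space sets_restrict_space)
  have intN: "integrable N f"
    unfolding N_def using int by (subst integrable_distr_eq[OF m f])
  have "integrable ?U (\<lambda>u. f (?I u))"
    using intN by (subst integrable_distr_eq[OF I f, symmetric]) (simp add: D.distr_I_eq_M)
  then have intI: "set_integrable lborel {0<..<1} (\<lambda>u. f (?I u))"
    by (simp add: integrable_restrict_space set_integrable_def)
  have "expectation (\<lambda>\<omega>. f (- X \<omega>)) = integral\<^sup>L N f"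
    unfolding N_def by (rule integral_distr[OF m f, symmetric])
  also have "\<dots> = integral\<^sup>L ?U (\<lambda>u. f (?I u))"
    by (subst integral_distr[OF I f, symmetric]) (simp add: D.distr_I_eq_M)
  also have "\<dots> = (LINT u:{0<..<1}|lborel. f (?I u))"
    by (simp add: integral_restrict_space set_lebesgue_integral_def)
  finally have eqI: "expectation (\<lambda>\<omega>. f (- X \<omega>)) = (LINT u:{0<..<1}|lborel. f (?I u))" .
  \<comment> \<open>Reflection of the levels at 1/2, written as the affine map
    \<open>1 + -1 * u\<close>: it preserves (0,1) and Lebesgue measure and turns the quantile
    function into \<open>VaR\<close>.\<close>
  have refl01: "indicator {0<..<1} (1 + -1 * u) *\<^sub>R f (?I (1 + -1 * u))
      = indicator {0<..<1} u *\<^sub>R f (VaR M u X)" for u :: real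
    unfolding VaR_conv_cdf[OF X] N_def by (auto simp: indicator_def)
  show "set_integrable lborel {0<..<1} (\<lambda>u. f (VaR M u X))"
    using intI unfolding set_integrable_def refl01[symmetric]
    by (subst lborel_integrable_real_affine_iff) auto
  show "(LINT u:{0<..<1}|lborel. f (VaR M u X)) = expectation (\<lambda>\<omega>. f (- X \<omega>))"
    unfolding eqI set_lebesgue_integral_def refl01[symmetric]
    by (subst (2) lborel_integral_real_affine[where c = "-1" and t = 1]) auto
qed

text \<open>The Rockafellar--Uryasev objective, minimised over \<open>m\<close> at the value at risk.\<close>

definition RU :: "'a measure \<Rightarrow> real \<Rightarrow> real \<Rightarrow> ('a \<Rightarrow> real) \<Rightarrow> real" where
  "RU M \<alpha> m X = m + (\<integral>\<omega>. max 0 (- m - X \<omega>) \<partial>M) / \<alpha>"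

text \<open>The difference \<open>VaR M u X - m\<close> is at most its positive part, and enlarging
  (0,\<alpha>) to (0,1) only adds to the integral of the latter, which the quantile transform
  evaluates. For \<open>m = VaR M \<alpha> X\<close> the difference is nonnegative below the level
  \<alpha> and nonpositive above it, so nothing is lost.\<close>

lemma (in prob_space)
  fixes X :: "'a \<Rightarrow> real"
  assumes X: "integrable M X" and \<alpha>: "0 < \<alpha>" "\<alpha> < 1"
  shows ES_le_RU: "ES M \<alpha> X \<le> RU M \<alpha> m X"
    and ES_eq_RU_VaR: "ES M \<alpha> X = RU M \<alpha> (VaR M \<alpha> X) X"
proof -
  let ?V = "\<lambda>u. VaR M u X"
  have Xm: "X \<in> borel_measurable M" using X by auto
  have V1: "set_integrable lborel {0<..<1} (\<lambda>u. ?V u)"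
    using VaR_integral(1)[OF Xm, of "\<lambda>x. x"] X by simp
  have V: "set_integrable lborel {0<..<\<alpha>} ?V"
    by (rule set_integrable_subset[OF V1]) (use \<alpha> in auto)
  have c: "set_integrable lborel {0<..<\<alpha>} (\<lambda>u. c::real)" for c
    unfolding set_integrable_def by (rule integrable_real_indicator[THEN integrable_scaleR_left]) (use \<alpha> in auto)
  have c': "(LINT u:{0<..<\<alpha>}|lborel. c) = \<alpha> * c" for c :: real
    using \<alpha> by (simp add: set_lebesgue_integral_def)
  \<comment> \<open>The interval integral runs over the open interval, so only levels occur at which
    \<open>VaR\<close> is a genuine quantile.\<close>
  have "einterval 0 \<alpha> = {0<..<\<alpha>}"
    by (auto simp: einterval_def zero_ereal_def)
  then have ES: "ES M \<alpha> X = (LINT u:{0<..<\<alpha>}|lborel. ?V u) / \<alpha>"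
    unfolding ES_def using \<alpha> by (subst interval_lebesgue_integral_le_eq) auto
  have pos: "set_integrable lborel {0<..<1} (\<lambda>u. max 0 (?V u - m))"
    "(LINT u:{0<..<1}|lborel. max 0 (?V u - m)) = expectation (\<lambda>\<omega>. max 0 (- m - X \<omega>))" for m
    using VaR_integral[OF Xm, of "\<lambda>x. max 0 (x - m)"] X by (simp_all add: minus_diff_commute)
  have diff: "set_integrable lborel {0<..<\<alpha>} (\<lambda>u. ?V u - m)"
    "(LINT u:{0<..<\<alpha>}|lborel. ?V u - m) = \<alpha> * ES M \<alpha> X - \<alpha> * m" for m
    using V c c' \<alpha> by (auto simp: ES)
  \<comment> \<open>Extension by zero puts both integrals on (0,1), where the integrands can be
    compared pointwise.\<close>
  have ind: "set_integrable lborel {0<..<1} (\<lambda>u. indicator {0<..<\<alpha>} u * (?V u - m))"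
    "(LINT u:{0<..<1}|lborel. indicator {0<..<\<alpha>} u * (?V u - m)) = \<alpha> * ES M \<alpha> X - \<alpha> * m" for m
  proof -
    have *: "indicator {0<..<1} u *\<^sub>R (indicator {0<..<\<alpha>} u * (?V u - m)) =
        indicator {0<..<\<alpha>} u *\<^sub>R (?V u - m)" for u :: real
      using \<alpha> by (auto simp: indicator_def)
    show "set_integrable lborel {0<..<1} (\<lambda>u. indicator {0<..<\<alpha>} u * (?V u - m))"
      "(LINT u:{0<..<1}|lborel. indicator {0<..<\<alpha>} u * (?V u - m)) = \<alpha> * ES M \<alpha> X - \<alpha> * m"
      using diff unfolding set_integrable_def set_lebesgue_integral_def * by auto
  qed
  have "\<alpha> * ES M \<alpha> X - \<alpha> * m \<le> expectation (\<lambda>\<omega>. max 0 (- m - X \<omega>))"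
    unfolding ind(2)[symmetric] pos(2)[symmetric]
    by (rule set_integral_mono[OF ind(1) pos(1)]) (auto simp: indicator_def)
  then show "ES M \<alpha> X \<le> RU M \<alpha> m X"
    using \<alpha> by (simp add: RU_def field_simps)
  define q where "q = VaR M \<alpha> X"
  have "\<alpha> * ES M \<alpha> X - \<alpha> * q = expectation (\<lambda>\<omega>. max 0 (- q - X \<omega>))"
    unfolding ind(2)[symmetric] pos(2)[symmetric] set_lebesgue_integral_def
  proof (intro Bochner_Integration.integral_cong refl)
    fix u :: real
    show "indicator {0<..<1} u *\<^sub>R (indicator {0<..<\<alpha>} u * (?V u - q)) =
        indicator {0<..<1} u *\<^sub>R max 0 (?V u - q)"
      using VaR_antimono[OF Xm, of u \<alpha>] VaR_antimono[OF Xm, of \<alpha> u] \<alpha>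
      by (auto simp: indicator_def q_def)
  qed
  then show "ES M \<alpha> X = RU M \<alpha> (VaR M \<alpha> X) X"
    using \<alpha> by (simp add: RU_def q_def field_simps)
qed

section \<open>Dual bounds from bounded densities\<close>

lemma (in prob_space) integrable_bounded_density:
  fixes Y :: "'a \<Rightarrow> 'b::{banach, second_countable_topology}"
  assumes "integrable M Y" "Z \<in> borel_measurable M" "AE \<omega> in M. \<bar>Z \<omega>\<bar> \<le> B"
  shows "integrable M (\<lambda>\<omega>. Z \<omega> *\<^sub>R Y \<omega>)"
proof (rule Bochner_Integration.integrable_bound)
  show "integrable M (\<lambda>\<omega>. B * norm (Y \<omega>))" using assms by auto
  show "(\<lambda>\<omega>. Z \<omega> *\<^sub>R Y \<omega>) \<in> borel_measurable M" using assms by measurable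
  show "AE \<omega> in M. norm (Z \<omega> *\<^sub>R Y \<omega>) \<le> norm (B * norm (Y \<omega>))"
    using assms(3) by eventually_elim (auto simp: abs_mult intro!: mult_right_mono)
qed

text \<open>At the minimising threshold \<open>m\<close>, the gap between \<open>ES\<close> and the
  dual value is the mean of the nonnegative \<open>?D\<close>. Under strict bounds on
  \<open>Z\<close> a vanishing gap kills both the positive and the negative part of
  \<open>?W\<close>, so \<open>X\<close> is constant; \<open>expectation Z = 1\<close> identifies
  the constant.\<close>

lemma (in prob_space)
  fixes X Z :: "'a \<Rightarrow> real"
  assumes X: "integrable M X" and \<alpha>: "0 < \<alpha>" "\<alpha> < 1"
    and Z: "Z \<in> borel_measurable M" and Z1: "expectation Z = 1"
    and bounds: "AE \<omega> in M. 0 \<le> Z \<omega> \<and> Z \<omega> \<le> 1 / \<alpha>"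
  shows ES_ge_density: "- expectation (\<lambda>\<omega>. Z \<omega> * X \<omega>) \<le> ES M \<alpha> X"
    and ES_eq_density_imp_const:
      "\<lbrakk>AE \<omega> in M. 0 < Z \<omega> \<and> Z \<omega> < 1 / \<alpha>; ES M \<alpha> X \<le> - expectation (\<lambda>\<omega>. Z \<omega> * X \<omega>)\<rbrakk>
        \<Longrightarrow> AE \<omega> in M. X \<omega> = expectation (\<lambda>\<omega>. Z \<omega> * X \<omega>)"
proof -
  define m where "m = VaR M \<alpha> X"
  let ?W = "\<lambda>\<omega>. - m - X \<omega>"
  let ?D = "\<lambda>\<omega>. max 0 (?W \<omega>) / \<alpha> - Z \<omega> * ?W \<omega>"
  have ae: "AE \<omega> in M. \<bar>Z \<omega>\<bar> \<le> 1 / \<alpha>" using bounds by eventually_elim auto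
  have iZ: "integrable M Z"
    using integrable_bounded_density[of "\<lambda>_. 1::real", OF _ Z ae] by simp
  have iZX: "integrable M (\<lambda>\<omega>. Z \<omega> * X \<omega>)"
    using integrable_bounded_density[OF X Z ae] by simp
  have iW: "integrable M (\<lambda>\<omega>. max 0 (?W \<omega>) / \<alpha>)" using X by simp
  have iZW: "integrable M (\<lambda>\<omega>. Z \<omega> * ?W \<omega>)"
    using iZ iZX by (simp add: algebra_simps)
  have ZW: "expectation (\<lambda>\<omega>. Z \<omega> * ?W \<omega>) = - m - expectation (\<lambda>\<omega>. Z \<omega> * X \<omega>)"
  proof -
    have "expectation (\<lambda>\<omega>. Z \<omega> * ?W \<omega>) = expectation (\<lambda>\<omega>. (- m) * Z \<omega> - Z \<omega> * X \<omega>)"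
      by (intro Bochner_Integration.integral_cong) (auto simp: algebra_simps)
    also have "\<dots> = - m - expectation (\<lambda>\<omega>. Z \<omega> * X \<omega>)"
      using iZ iZX Z1 by (subst Bochner_Integration.integral_diff) auto
    finally show ?thesis .
  qed
  have D: "expectation ?D = ES M \<alpha> X + expectation (\<lambda>\<omega>. Z \<omega> * X \<omega>)"
    using iW iZW unfolding ES_eq_RU_VaR[OF X \<alpha>] m_def[symmetric] RU_def
    by (subst Bochner_Integration.integral_diff) (auto simp: ZW)
  \<comment> \<open>Writing \<open>?W\<close> as positive minus negative part leaves two weights
    that are nonnegative exactly by the density bounds.\<close>
  have split: "?D \<omega> = (1 / \<alpha> - Z \<omega>) * max 0 (?W \<omega>) + Z \<omega> * max 0 (- ?W \<omega>)" for \<omega>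
    by (auto simp: max_def algebra_simps)
  have nonneg: "AE \<omega> in M. 0 \<le> ?D \<omega>"
    using bounds unfolding split by eventually_elim (auto intro!: add_nonneg_nonneg mult_nonneg_nonneg)
  show "- expectation (\<lambda>\<omega>. Z \<omega> * X \<omega>) \<le> ES M \<alpha> X"
    using integral_nonneg_AE[OF nonneg] D by simp
  assume strict: "AE \<omega> in M. 0 < Z \<omega> \<and> Z \<omega> < 1 / \<alpha>"
    and le: "ES M \<alpha> X \<le> - expectation (\<lambda>\<omega>. Z \<omega> * X \<omega>)"
  have "expectation ?D = 0"
    using integral_nonneg_AE[OF nonneg] D le by simp
  then have "AE \<omega> in M. ?D \<omega> = 0"
    using integral_nonneg_eq_0_iff_AE[OF _ nonneg] iW iZW by auto
  with strict have const: "AE \<omega> in M. X \<omega> = - m"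
  proof eventually_elim
    case (elim \<omega>)
    then have "(1 / \<alpha> - Z \<omega>) * max 0 (?W \<omega>) = 0" "Z \<omega> * max 0 (- ?W \<omega>) = 0"
      unfolding split by (smt (verit) mult_nonneg_nonneg)+
    then show ?case using elim by (auto simp: max_def split: if_splits)
  qed
  have "expectation (\<lambda>\<omega>. Z \<omega> * X \<omega>) = expectation (\<lambda>\<omega>. - m * Z \<omega>)"
    using const X Z by (intro integral_cong_AE) (auto elim: eventually_mono)
  then have "expectation (\<lambda>\<omega>. Z \<omega> * X \<omega>) = - m" using Z1 by simp
  with const show "AE \<omega> in M. X \<omega> = expectation (\<lambda>\<omega>. Z \<omega> * X \<omega>)" by simp
qed

section \<open>Sublinearity of expected shortfall\<close>

text \<open>Homogeneity of the positive part. Threshold and position are scaled together, since the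
  later coercivity argument treats them as one vector.\<close>

lemma RU_scale:
  assumes "0 \<le> c"
  shows "RU M \<alpha> (c * m) (\<lambda>\<omega>. c * X \<omega>) = c * RU M \<alpha> m X"
proof -
  have "max 0 (- (c * m) - c * X \<omega>) = c * max 0 (- m - X \<omega>)" for \<omega>
    using assms by (simp add: max_mult_distrib_left algebra_simps)
  then show ?thesis by (simp add: RU_def algebra_simps)
qed

text \<open>Subadditivity of the positive part, again jointly in threshold and position.\<close>

lemma (in prob_space) RU_add:
  fixes X Y :: "'a \<Rightarrow> real"
  assumes "integrable M X" "integrable M Y" "0 < \<alpha>"
  shows "RU M \<alpha> (m + n) (\<lambda>\<omega>. X \<omega> + Y \<omega>) \<le> RU M \<alpha> m X + RU M \<alpha> n Y"
proof -
  have "expectation (\<lambda>\<omega>. max 0 (- (m + n) - (X \<omega> + Y \<omega>)))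
      \<le> expectation (\<lambda>\<omega>. max 0 (- m - X \<omega>) + max 0 (- n - Y \<omega>))"
    using assms by (intro integral_mono) auto
  also have "\<dots> = expectation (\<lambda>\<omega>. max 0 (- m - X \<omega>)) + expectation (\<lambda>\<omega>. max 0 (- n - Y \<omega>))"
    using assms by (intro Bochner_Integration.integral_add) auto
  finally have "expectation (\<lambda>\<omega>. max 0 (- (m + n) - (X \<omega> + Y \<omega>))) / \<alpha>
      \<le> (expectation (\<lambda>\<omega>. max 0 (- m - X \<omega>)) + expectation (\<lambda>\<omega>. max 0 (- n - Y \<omega>))) / \<alpha>"
    using assms by (intro divide_right_mono) auto
  then show ?thesis
    by (simp add: RU_def add_divide_distrib)
qed

text \<open>The sum of the two minimising thresholds is a competitor for the sum of the
  positions.\<close>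

lemma (in prob_space) ES_add:
  fixes X Y :: "'a \<Rightarrow> real"
  assumes "integrable M X" "integrable M Y" "0 < \<alpha>" "\<alpha> < 1"
  shows "ES M \<alpha> (\<lambda>\<omega>. X \<omega> + Y \<omega>) \<le> ES M \<alpha> X + ES M \<alpha> Y"
  using ES_le_RU[of "\<lambda>\<omega>. X \<omega> + Y \<omega>" \<alpha> "VaR M \<alpha> X + VaR M \<alpha> Y"]
    RU_add[of X Y \<alpha> "VaR M \<alpha> X" "VaR M \<alpha> Y"] ES_eq_RU_VaR[of X \<alpha>] ES_eq_RU_VaR[of Y \<alpha>] assms
  by simp

text \<open>The scaled minimiser is a competitor, which gives one inequality; the other is the same
  inequality for the factor \<open>inverse c\<close>. For \<open>c = 0\<close> the risk of the zero
  position is squeezed between threshold 0 and the density 1.\<close>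

lemma (in prob_space) ES_scale:
  fixes X :: "'a \<Rightarrow> real"
  assumes X: "integrable M X" and \<alpha>: "0 < \<alpha>" "\<alpha> < 1" and c: "0 \<le> c"
  shows "ES M \<alpha> (\<lambda>\<omega>. c * X \<omega>) = c * ES M \<alpha> X"
proof (cases "c = 0")
  case True
  have "ES M \<alpha> (\<lambda>\<omega>. 0) \<le> 0"
    using ES_le_RU[of "\<lambda>\<omega>. 0" \<alpha> 0] \<alpha> by (simp add: RU_def)
  moreover have "0 \<le> ES M \<alpha> (\<lambda>\<omega>. 0)"
    using ES_ge_density[of "\<lambda>\<omega>. 0" \<alpha> "\<lambda>\<omega>. 1"] \<alpha> by (simp add: prob_space)
  ultimately show ?thesis using True by simp
next
  case False
  have le: "ES M \<alpha> (\<lambda>\<omega>. k * Y \<omega>) \<le> k * ES M \<alpha> Y" if "integrable M Y" "0 \<le> k" for k Y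
    using ES_le_RU[of "\<lambda>\<omega>. k * Y \<omega>" \<alpha> "k * VaR M \<alpha> Y"] RU_scale[of k M \<alpha> "VaR M \<alpha> Y" Y]
      ES_eq_RU_VaR[of Y \<alpha>] that \<alpha> by simp
  have "ES M \<alpha> X \<le> inverse c * ES M \<alpha> (\<lambda>\<omega>. c * X \<omega>)"
    using le[of "\<lambda>\<omega>. c * X \<omega>" "inverse c"] X c False by (simp flip: mult.assoc)
  with le[OF X c] c False show ?thesis by (simp add: field_simps)
qed

section \<open>Sublinear functions on Euclidean space\<close>

text \<open>Sublinear functions are convex, hence continuous in finite dimension. On a closed cone
  positivity becomes uniform: take the minimum over the compact unit slice and extend by
  homogeneity.\<close>

lemma
  fixes f :: "'v::euclidean_space \<Rightarrow> real"
  assumes add: "\<And>x y. f (x + y) \<le> f x + f y"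
    and scale: "\<And>c x. 0 \<le> c \<Longrightarrow> f (c *\<^sub>R x) = c * f x"
  shows sublinear_imp_continuous_on: "continuous_on UNIV f"
    and sublinear_pos_imp_coercive:
      "\<lbrakk>closed S; \<And>c x. c \<ge> 0 \<Longrightarrow> x \<in> S \<Longrightarrow> c *\<^sub>R x \<in> S; \<And>x. x \<in> S \<Longrightarrow> x \<noteq> 0 \<Longrightarrow> 0 < f x\<rbrakk>
        \<Longrightarrow> \<exists>c>0. \<forall>x\<in>S. c * norm x \<le> f x"
proof -
  have convex: "convex_on UNIV f"
  proof (rule convex_onI)
    fix t :: real and x y :: 'v
    assume t: "0 < t" "t < 1"
    have "f ((1 - t) *\<^sub>R x + t *\<^sub>R y) \<le> f ((1 - t) *\<^sub>R x) + f (t *\<^sub>R y)" by (rule add)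
    also have "\<dots> = (1 - t) * f x + t * f y" using t by (simp add: scale)
    finally show "f ((1 - t) *\<^sub>R x + t *\<^sub>R y) \<le> (1 - t) * f x + t * f y" .
  qed simp
  show cont: "continuous_on UNIV f"
    by (rule convex_on_continuous[OF open_UNIV convex])
  assume S: "closed S" and cone: "\<And>c x. c \<ge> 0 \<Longrightarrow> x \<in> S \<Longrightarrow> c *\<^sub>R x \<in> S"
    and pos: "\<And>x. x \<in> S \<Longrightarrow> x \<noteq> 0 \<Longrightarrow> 0 < f x"
  let ?K = "S \<inter> sphere 0 1"
  have "\<exists>c>0. \<forall>x\<in>?K. c \<le> f x"
  proof (cases "?K = {}")
    case False
    have "compact ?K" using S by (intro closed_Int_compact) auto
    then obtain x where "x \<in> ?K" "\<forall>y\<in>?K. f x \<le> f y"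
      using continuous_attains_inf[OF _ False continuous_on_subset[OF cont]] by blast
    then show ?thesis by (intro exI[of _ "f x"]) (auto intro!: pos)
  \<comment> \<open>An empty slice imposes no condition, so 1 serves as the constant.\<close>
  qed (auto intro: exI[of _ 1])
  then obtain c where c: "c > 0" "\<And>x. x \<in> ?K \<Longrightarrow> c \<le> f x" by blast
  have "c * norm x \<le> f x" if "x \<in> S" for x
  proof (cases "x = 0")
    case True
    then show ?thesis using scale[of 0 x] by simp
  next
    case False
    then have "inverse (norm x) *\<^sub>R x \<in> ?K" using that cone by auto
    then have "c \<le> inverse (norm x) * f x" using c(2) scale[of "inverse (norm x)" x] by force
    then show ?thesis using False by (simp add: field_simps)
  qed
  with c show "\<exists>c>0. \<forall>x\<in>S. c * norm x \<le> f x" by blast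
qed

section \<open>Integrals against densities with two-sided bounds\<close>

text \<open>A zonoid generated by \<open>Y\<close>. Bounding \<open>Z\<close> everywhere instead of
  almost everywhere permits pointwise verification; limits are clamped into the bounds.\<close>

definition density_integrals :: "'a measure \<Rightarrow> real \<Rightarrow> real \<Rightarrow> ('a \<Rightarrow> 'v::euclidean_space) \<Rightarrow> 'v set" where
  "density_integrals M a b Y =
     {(\<integral>\<omega>. Z \<omega> *\<^sub>R Y \<omega> \<partial>M) | Z. Z \<in> borel_measurable M \<and> (\<forall>\<omega>. a \<le> Z \<omega> \<and> Z \<omega> \<le> b)}"

lemma convex_comb_bounds:
  fixes x y a b t :: real
  assumes "0 \<le> t" "t \<le> 1" "a \<le> x \<and> x \<le> b" "a \<le> y \<and> y \<le> b"
  shows "a \<le> (1 - t) * x + t * y \<and> (1 - t) * x + t * y \<le> b"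
proof -
  have "convex {a..b}" by simp
  from convexD[OF this, of x y "1 - t" t] assms show ?thesis by auto
qed

lemma (in prob_space) integral_convex_comb_density:
  fixes Y :: "'a \<Rightarrow> 'v::euclidean_space"
  assumes Y: "integrable M Y"
    and Z: "Z \<in> borel_measurable M" "\<And>\<omega>. a \<le> Z \<omega> \<and> Z \<omega> \<le> b"
    and Z': "Z' \<in> borel_measurable M" "\<And>\<omega>. a \<le> Z' \<omega> \<and> Z' \<omega> \<le> b"
  shows "(\<integral>\<omega>. ((1 - t) * Z \<omega> + t * Z' \<omega>) *\<^sub>R Y \<omega> \<partial>M) =
      (1 - t) *\<^sub>R (\<integral>\<omega>. Z \<omega> *\<^sub>R Y \<omega> \<partial>M) + t *\<^sub>R (\<integral>\<omega>. Z' \<omega> *\<^sub>R Y \<omega> \<partial>M)"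
proof -
  have bound: "\<bar>x\<bar> \<le> max \<bar>a\<bar> \<bar>b\<bar>" if "a \<le> x \<and> x \<le> b" for x using that by auto
  have "integrable M (\<lambda>\<omega>. Z \<omega> *\<^sub>R Y \<omega>)" "integrable M (\<lambda>\<omega>. Z' \<omega> *\<^sub>R Y \<omega>)"
    using Z Z' by (auto intro!: integrable_bounded_density[OF Y, where B = "max \<bar>a\<bar> \<bar>b\<bar>"] bound
      simp del: max.bounded_iff le_max_iff_disj)
  then show ?thesis
    unfolding scaleR_add_left scaleR_scaleR[symmetric]
    by (subst Bochner_Integration.integral_add) (auto simp del: scaleR_scaleR)
qed

lemma (in prob_space) convex_density_integrals:
  fixes Y :: "'a \<Rightarrow> 'v::euclidean_space"
  assumes Y: "integrable M Y"
  shows "convex (density_integrals M a b Y)"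
  unfolding convex_alt
proof (intro ballI allI impI)
  fix x y and t :: real
  assume x: "x \<in> density_integrals M a b Y" and y: "y \<in> density_integrals M a b Y"
    and t: "0 \<le> t \<and> t \<le> 1"
  from x obtain Z where Z: "x = (\<integral>\<omega>. Z \<omega> *\<^sub>R Y \<omega> \<partial>M)"
    "Z \<in> borel_measurable M" "\<And>\<omega>. a \<le> Z \<omega> \<and> Z \<omega> \<le> b" by (auto simp: density_integrals_def)
  from y obtain Z' where Z': "y = (\<integral>\<omega>. Z' \<omega> *\<^sub>R Y \<omega> \<partial>M)"
    "Z' \<in> borel_measurable M" "\<And>\<omega>. a \<le> Z' \<omega> \<and> Z' \<omega> \<le> b" by (auto simp: density_integrals_def)
  have "(1 - t) *\<^sub>R x + t *\<^sub>R y = (\<integral>\<omega>. ((1 - t) * Z \<omega> + t * Z' \<omega>) *\<^sub>R Y \<omega> \<partial>M)"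
    unfolding Z Z' by (rule integral_convex_comb_density[OF Y Z(2,3) Z'(2,3), symmetric])
  moreover have "(\<lambda>\<omega>. (1 - t) * Z \<omega> + t * Z' \<omega>) \<in> borel_measurable M" using Z Z' by measurable
  moreover have "\<forall>\<omega>. a \<le> (1 - t) * Z \<omega> + t * Z' \<omega> \<and> (1 - t) * Z \<omega> + t * Z' \<omega> \<le> b"
    using t Z(3) Z'(3) by (intro allI convex_comb_bounds) auto
  ultimately show "(1 - t) *\<^sub>R x + t *\<^sub>R y \<in> density_integrals M a b Y"
    unfolding density_integrals_def by (intro CollectI exI[of _ "\<lambda>\<omega>. (1 - t) * Z \<omega> + t * Z' \<omega>"]) simp
qed

text \<open>Instead of weak compactness: densities of nearly minimal second moment among those whose
  integral is close to the limit point form an \<open>L\<^sup>2\<close>-Cauchy sequence by the parallelogram law.\<close>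

lemma (in prob_space) closed_density_integrals:
  fixes Y :: "'a \<Rightarrow> 'v::euclidean_space"
  assumes Y: "integrable M Y"
  shows "closed (density_integrals M a b Y)"
proof (subst closure_subset_eq[symmetric], rule subsetI)
  fix x assume x: "x \<in> closure (density_integrals M a b Y)"
  define B where "B = max \<bar>a\<bar> \<bar>b\<bar>"
  define F where "F = {Z. Z \<in> borel_measurable M \<and> (\<forall>\<omega>. a \<le> Z \<omega> \<and> Z \<omega> \<le> b)}"
  define J where "J Z = (\<integral>\<omega>. Z \<omega> *\<^sub>R Y \<omega> \<partial>M)" for Z
  define q where "q Z = expectation (\<lambda>\<omega>. (Z \<omega>)\<^sup>2)" for Z :: "'a \<Rightarrow> real"
  define S where "S n = {Z \<in> F. norm (J Z - x) \<le> 1 / Suc n}" for n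
  \<comment> \<open>The sets \<open>S n\<close> shrink, so \<open>d\<close> increases; it is bounded
    by \<open>B\<^sup>2\<close> and therefore converges.\<close>
  define d where "d n = (INF Z\<in>S n. q Z)" for n
  have bound: "\<bar>Z \<omega>\<bar> \<le> B" if "Z \<in> F" for Z \<omega>
  proof -
    have "a \<le> Z \<omega>" "Z \<omega> \<le> b" using that by (auto simp: F_def)
    then show ?thesis by (auto simp: B_def)
  qed
  have meas: "Z \<in> borel_measurable M" if "Z \<in> F" for Z using that by (simp add: F_def)
  have sq: "(Z \<omega>)\<^sup>2 \<le> B\<^sup>2" if "Z \<in> F" for Z \<omega>
    using bound[OF that, of \<omega>] by (simp add: abs_le_square_iff[symmetric] abs_of_nonneg B_def)
  have int1: "integrable M Z" if "Z \<in> F" for Z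
    by (rule integrable_const_bound[of _ B]) (auto simp: bound that meas)
  have int2: "integrable M (\<lambda>\<omega>. Z \<omega> * Z' \<omega>)" if "Z \<in> F" "Z' \<in> F" for Z Z'
    using integrable_bounded_density[OF int1[OF that(2)] meas[OF that(1)], of B] bound that by auto
  have q0: "0 \<le> q Z" for Z unfolding q_def by simp
  have qB: "q Z \<le> B\<^sup>2" if "Z \<in> F" for Z
    unfolding q_def by (rule integral_le_const) (use int2[OF that that] sq[OF that] in \<open>auto simp: power2_eq_square\<close>)
  have bdd: "bdd_below (q ` S n)" for n by (rule bdd_belowI[of _ 0]) (auto simp: q0)
  have ne: "S n \<noteq> {}" for n
  proof -
    obtain y where "y \<in> density_integrals M a b Y" "dist y x < 1 / Suc n"
      using x closure_approachable[of x] by (meson of_nat_0_less_iff zero_less_Suc zero_less_divide_1_iff)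
    then show ?thesis by (auto simp: density_integrals_def S_def F_def J_def dist_norm intro: less_imp_le)
  qed
  have antimono: "S m \<subseteq> S n" if "n \<le> m" for n m
  proof -
    have "1 / Suc m \<le> 1 / Suc n" using that by (simp add: frac_le)
    then show ?thesis by (auto simp: S_def)
  qed
  have "\<exists>Z\<in>S n. q Z < d n + 1 / Suc n" for n
    using cINF_less_iff[OF ne bdd, of n "d n + 1 / Suc n"] by (auto simp: d_def)
  then obtain Z where ZS: "Z n \<in> S n" and Zq: "q (Z n) < d n + 1 / Suc n" for n by metis
  have ZF: "Z n \<in> F" for n using ZS by (auto simp: S_def)
  have d_mono: "d n \<le> d m" if "n \<le> m" for n m
    unfolding d_def by (rule cINF_superset_mono[OF ne bdd antimono[OF that]]) auto
  have "norm (d n) \<le> B\<^sup>2" for n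
  proof -
    have "0 \<le> d n" unfolding d_def by (rule cINF_greatest[OF ne]) (rule q0)
    moreover have "d n \<le> B\<^sup>2"
      using cINF_lower[OF bdd ZS[of n]] qB[OF ZF[of n]] by (simp add: d_def)
    ultimately show ?thesis by simp
  qed
  then have "convergent d"
    using d_mono by (intro Bseq_mono_convergent BseqI'[of _ "B\<^sup>2"]) auto
  then have d_Cauchy: "Cauchy d" by (rule convergent_Cauchy)
  have parallelogram: "expectation (\<lambda>\<omega>. (Z n \<omega> - Z m \<omega>)\<^sup>2) \<le> 2 * (d m - d n) + 4 / Suc n"
    if nm: "n \<le> m" for n m
  proof -
    \<comment> \<open>The midpoint of \<open>Z n\<close> and \<open>Z m\<close> stays in
      \<open>S n\<close> by convexity of the ball, so its second moment is at least
      \<open>d n\<close>. The weight \<open>1 - 1/2\<close> matches the form of the convex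
      combination lemmas.\<close>
    define A where "A = (\<lambda>\<omega>. (1 - 1/2) * Z n \<omega> + 1/2 * Z m \<omega>)"
    have AF: "A \<in> F"
    proof -
      have "A \<in> borel_measurable M" using meas[OF ZF[of n]] meas[OF ZF[of m]] unfolding A_def by measurable
      moreover have "a \<le> A \<omega> \<and> A \<omega> \<le> b" for \<omega>
        unfolding A_def using ZF[of n] ZF[of m] by (intro convex_comb_bounds) (auto simp: F_def)
      ultimately show ?thesis by (simp add: F_def)
    qed
    have "J A = (1 - 1/2) *\<^sub>R J (Z n) + (1/2) *\<^sub>R J (Z m)"
      unfolding J_def A_def using ZF by (intro integral_convex_comb_density[OF Y]) (auto simp: F_def)
    moreover have "J (Z n) \<in> cball x (1 / Suc n)" "J (Z m) \<in> cball x (1 / Suc n)"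
      using ZS[of n] ZS[of m] antimono[OF nm] by (auto simp: S_def dist_norm norm_minus_commute)
    ultimately have "J A \<in> cball x (1 / Suc n)"
      using convexD[OF convex_cball, of "J (Z n)" x "1 / Suc n" "J (Z m)" "1 - 1/2" "1/2"] by simp
    then have "A \<in> S n" using AF by (auto simp: S_def dist_norm norm_minus_commute)
    then have dA: "d n \<le> q A" unfolding d_def by (rule cINF_lower[OF bdd])
    have "expectation (\<lambda>\<omega>. (Z n \<omega> - Z m \<omega>)\<^sup>2)
        = expectation (\<lambda>\<omega>. 2 * (Z n \<omega> * Z n \<omega>) + 2 * (Z m \<omega> * Z m \<omega>) - 4 * (A \<omega> * A \<omega>))"
      by (intro Bochner_Integration.integral_cong refl) (simp add: A_def power2_eq_square field_simps)
    also have "\<dots> = 2 * q (Z n) + 2 * q (Z m) - 4 * q A"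
      unfolding q_def power2_eq_square
      by (subst Bochner_Integration.integral_diff Bochner_Integration.integral_add;
          (intro Bochner_Integration.integrable_add integrable_mult_right int2 ZF AF)?)+ simp
    also have "\<dots> \<le> 2 * (d n + 1 / Suc n) + 2 * (d m + 1 / Suc n) - 4 * d n"
    proof -
      have "1 / real (Suc m) \<le> 1 / Suc n" using nm by (simp add: frac_le)
      then have "q (Z m) \<le> d m + 1 / Suc n"
        by (rule order.trans[OF less_imp_le[OF Zq] add_left_mono])
      then show ?thesis
        using less_imp_le[OF Zq[of n]] dA by (intro diff_mono add_mono mult_left_mono) auto
    qed
    also have "\<dots> = 2 * (d m - d n) + 4 / Suc n" by (simp add: algebra_simps)
    finally show ?thesis .
  qed
  have L1_Cauchy: "\<exists>N. \<forall>i\<ge>N. \<forall>j\<ge>N. (\<integral>\<omega>. norm (Z i \<omega> - Z j \<omega>) \<partial>M) < e" if e: "e > 0" for e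
  proof -
    \<comment> \<open>The tolerances are tuned to the parallelogram estimate:
      \<open>2 * (e\<^sup>2 / 4) + 4 * (e\<^sup>2 / 8) = e\<^sup>2\<close>.\<close>
    obtain N1 where N1: "\<And>i j. i \<ge> N1 \<Longrightarrow> j \<ge> N1 \<Longrightarrow> norm (d i - d j) < e\<^sup>2 / 4"
      using CauchyD[OF d_Cauchy, of "e\<^sup>2 / 4"] e by auto
    obtain N2 where N2: "1 / real (Suc N2) < e\<^sup>2 / 8"
      using nat_approx_posE[of "e\<^sup>2 / 8"] e by auto
    have main: "(\<integral>\<omega>. norm (Z i \<omega> - Z j \<omega>) \<partial>M) < e" if ij: "max N1 N2 \<le> i" "i \<le> j" for i j
    proof -
      have "1 / real (Suc i) \<le> 1 / Suc N2" using ij by (intro frac_le) auto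
      then have "1 / real (Suc i) < e\<^sup>2 / 8" using N2 by (rule le_less_trans)
      from mult_strict_left_mono[OF this, of 4] have "4 / real (Suc i) < e\<^sup>2 / 2" by simp
      moreover have "d j - d i < e\<^sup>2 / 4" by (rule le_less_trans[OF _ N1[of j i]]) (use ij in auto)
      ultimately have "2 * (d j - d i) + 4 / Suc i < 2 * (e\<^sup>2 / 4) + e\<^sup>2 / 2"
        by (intro add_strict_mono mult_strict_left_mono) auto
      with parallelogram[OF ij(2)] have "expectation (\<lambda>\<omega>. (Z i \<omega> - Z j \<omega>)\<^sup>2) < 2 * (e\<^sup>2 / 4) + e\<^sup>2 / 2"
        by (rule le_less_trans)
      then have sq: "expectation (\<lambda>\<omega>. (Z i \<omega> - Z j \<omega>)\<^sup>2) < e\<^sup>2" by simp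
      have i2: "integrable M (\<lambda>\<omega>. (Z i \<omega> - Z j \<omega>)\<^sup>2)"
        using int2[OF ZF[of i] ZF[of i]] int2[OF ZF[of i] ZF[of j]] int2[OF ZF[of j] ZF[of j]]
        by (simp add: power2_eq_square algebra_simps)
      \<comment> \<open>From second moments to the L1 norm: expanding
        \<open>(\<bar>x\<bar> - e)\<^sup>2 \<ge> 0\<close> bounds \<open>\<bar>x\<bar>\<close> by
        \<open>(e + x\<^sup>2 / e) / 2\<close>, whose mean is below \<open>e\<close>.\<close>
      have "(\<integral>\<omega>. norm (Z i \<omega> - Z j \<omega>) \<partial>M) \<le> expectation (\<lambda>\<omega>. (e + (Z i \<omega> - Z j \<omega>)\<^sup>2 / e) / 2)"
      proof (intro integral_mono)
        fix \<omega>
        have "0 \<le> (\<bar>Z i \<omega> - Z j \<omega>\<bar> - e)\<^sup>2" by simp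
        then have "2 * e * \<bar>Z i \<omega> - Z j \<omega>\<bar> \<le> e\<^sup>2 + (Z i \<omega> - Z j \<omega>)\<^sup>2"
          by (simp add: power2_diff algebra_simps)
        then show "norm (Z i \<omega> - Z j \<omega>) \<le> (e + (Z i \<omega> - Z j \<omega>)\<^sup>2 / e) / 2"
          using e by (simp add: field_simps power2_eq_square)
      qed (use i2 int1 ZF in auto)
      also have "\<dots> = (e + expectation (\<lambda>\<omega>. (Z i \<omega> - Z j \<omega>)\<^sup>2) / e) / 2"
        using i2 by (simp add: prob_space)
      also have "\<dots> < e" using sq e by (simp add: field_simps power2_eq_square)
      finally show ?thesis .
    qed
    show ?thesis
    proof (intro exI[of _ "max N1 N2"] allI impI)
      fix i j assume "max N1 N2 \<le> i" "max N1 N2 \<le> j"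
      then show "(\<integral>\<omega>. norm (Z i \<omega> - Z j \<omega>) \<partial>M) < e"
        using main[of i j] main[of j i] by (cases "i \<le> j") (auto simp: abs_minus_commute)
    qed
  qed
  obtain s where s: "strict_mono s" "AE \<omega> in M. Cauchy (\<lambda>i. Z (s i) \<omega>)"
    using cauchy_L1_AE_cauchy_subseq[OF int1[OF ZF] L1_Cauchy] by blast
  \<comment> \<open>Where the subsequence diverges \<open>lim\<close> is unspecified; clamping
    forces membership in \<open>F\<close> everywhere and leaves genuine limits unchanged.\<close>
  define L where "L \<omega> = max a (min b (lim (\<lambda>i. Z (s i) \<omega>)))" for \<omega>
  have ab: "a \<le> b" using ZF[of 0] by (auto simp: F_def intro: order_trans)
  have [measurable]: "Z n \<in> borel_measurable M" for n by (rule meas[OF ZF])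
  have LF: "L \<in> F" unfolding F_def L_def using ab by (auto intro!: borel_measurable_max borel_measurable_min borel_measurable_lim_metric)
  have lim: "AE \<omega> in M. (\<lambda>i. Z (s i) \<omega>) \<longlonglongrightarrow> L \<omega>"
    using s(2)
  proof eventually_elim
    case (elim \<omega>)
    then have c: "(\<lambda>i. Z (s i) \<omega>) \<longlonglongrightarrow> lim (\<lambda>i. Z (s i) \<omega>)"
      by (simp add: Cauchy_convergent_iff convergent_LIMSEQ_iff)
    have "a \<le> lim (\<lambda>i. Z (s i) \<omega>)" "lim (\<lambda>i. Z (s i) \<omega>) \<le> b"
      using ZF by (auto simp: F_def intro!: LIMSEQ_le_const[OF c] LIMSEQ_le_const2[OF c])
    with c show ?case by (simp add: L_def)
  qed
  have "(\<lambda>i. J (Z (s i))) \<longlonglongrightarrow> J L"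
    unfolding J_def
  proof (rule integral_dominated_convergence)
    show "integrable M (\<lambda>\<omega>. B * norm (Y \<omega>))" using Y by auto
    show "AE \<omega> in M. (\<lambda>i. Z (s i) \<omega> *\<^sub>R Y \<omega>) \<longlonglongrightarrow> L \<omega> *\<^sub>R Y \<omega>"
      using lim by eventually_elim (auto intro!: tendsto_intros)
    show "AE \<omega> in M. norm (Z (s i) \<omega> *\<^sub>R Y \<omega>) \<le> B * norm (Y \<omega>)" for i
      by (auto intro!: mult_right_mono bound ZF)
  qed (use Y meas[OF LF] in \<open>auto intro!: borel_measurable_scaleR\<close>)
  moreover have "(\<lambda>i. J (Z (s i))) \<longlonglongrightarrow> x"
  proof -
    have "(\<lambda>n. J (Z n) - x) \<longlonglongrightarrow> 0"
      by (rule Lim_null_comparison[OF _ LIMSEQ_inverse_real_of_nat])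
         (use ZS in \<open>auto simp: S_def inverse_eq_divide\<close>)
    then have "(\<lambda>n. J (Z n)) \<longlonglongrightarrow> x" by (simp add: LIM_zero_iff)
    from LIMSEQ_subseq_LIMSEQ[OF this s(1)] show ?thesis by (simp add: o_def)
  qed
  ultimately have "x = J L" by (metis LIMSEQ_unique)
  then show "x \<in> density_integrals M a b Y"
    using LF by (auto simp: density_integrals_def J_def F_def)
qed

text \<open>Separate \<open>z\<close> strictly from the closed convex set and evaluate the
  separation at the point where \<open>v\<close> is smallest. That point comes from the bang-bang
  density equal to \<open>b\<close> where \<open>v \<bullet> Y \<omega>\<close> is negative and to
  \<open>a\<close> elsewhere. Strictness forces \<open>v \<noteq> 0\<close>.\<close>

lemma (in prob_space) not_in_density_integrals:
  fixes Y :: "'a \<Rightarrow> 'v::euclidean_space"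
  assumes Y: "integrable M Y" and ab: "a \<le> b" and z: "z \<notin> density_integrals M a b Y"
  obtains v where "v \<noteq> 0"
    "v \<bullet> z + expectation (\<lambda>\<omega>. b * max 0 (- (v \<bullet> Y \<omega>)) - a * max 0 (v \<bullet> Y \<omega>)) < 0"
proof -
  obtain v k where v: "v \<bullet> z < k" "\<And>y. y \<in> density_integrals M a b Y \<Longrightarrow> k < v \<bullet> y"
    using separating_hyperplane_closed_point[OF convex_density_integrals[OF Y] closed_density_integrals[OF Y] z]
    by blast
  define Z where "Z \<omega> = (if v \<bullet> Y \<omega> < 0 then b else a)" for \<omega>
  have [measurable]: "Y \<in> borel_measurable M" using Y by auto
  have Zm: "Z \<in> borel_measurable M" unfolding Z_def by measurable
  have "integrable M (\<lambda>\<omega>. Z \<omega> *\<^sub>R Y \<omega>)"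
    by (rule integrable_bounded_density[OF Y Zm, of "max \<bar>a\<bar> \<bar>b\<bar>"]) (auto simp: Z_def)
  then have "v \<bullet> (\<integral>\<omega>. Z \<omega> *\<^sub>R Y \<omega> \<partial>M) = expectation (\<lambda>\<omega>. v \<bullet> (Z \<omega> *\<^sub>R Y \<omega>))"
    by (intro integral_inner_right[symmetric]) auto
  also have "\<dots> = expectation (\<lambda>\<omega>. - (b * max 0 (- (v \<bullet> Y \<omega>)) - a * max 0 (v \<bullet> Y \<omega>)))"
    by (intro Bochner_Integration.integral_cong) (auto simp: Z_def max_def)
  finally have "v \<bullet> (\<integral>\<omega>. Z \<omega> *\<^sub>R Y \<omega> \<partial>M) =
      - expectation (\<lambda>\<omega>. b * max 0 (- (v \<bullet> Y \<omega>)) - a * max 0 (v \<bullet> Y \<omega>))"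
    unfolding integral_minus .
  moreover have mem: "(\<integral>\<omega>. Z \<omega> *\<^sub>R Y \<omega> \<partial>M) \<in> density_integrals M a b Y"
    unfolding density_integrals_def using Zm ab by (intro CollectI exI[of _ Z]) (auto simp: Z_def)
  ultimately show thesis
    using v(1) v(2)[OF mem] by (intro that[of v]) auto
qed

section \<open>Coordinate-free market and the risk of its portfolios\<close>

text \<open>\<open>R\<close> stands for the vector of excess returns. Eliminating the riskless asset
  turns nonredundancy into linear independence of the components of \<open>R\<close> modulo null
  sets, and an asset with mean return different from the interest rate into a nonzero mean
  vector.\<close>

locale ES_market = prob_space M for M :: "'a measure" +
  fixes R :: "'a \<Rightarrow> 'v::euclidean_space" and \<alpha> :: real
  assumes R: "integrable M R"
    and \<alpha>: "0 < \<alpha>" "\<alpha> < 1"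
    and nonredundant: "\<And>\<pi>. AE \<omega> in M. \<pi> \<bullet> R \<omega> = 0 \<Longrightarrow> \<pi> = 0"
    and mean_nonzero: "expectation R \<noteq> 0"
begin

definition risk :: "'v \<Rightarrow> real" where
  "risk \<pi> = ES M \<alpha> (\<lambda>\<omega>. \<pi> \<bullet> R \<omega>)"

lemma integrable_excess: "integrable M (\<lambda>\<omega>. \<pi> \<bullet> R \<omega>)"
  using R by auto

lemma expectation_excess: "expectation (\<lambda>\<omega>. \<pi> \<bullet> R \<omega>) = \<pi> \<bullet> expectation R"
  using R by auto

lemma risk_add: "risk (\<pi> + \<pi>') \<le> risk \<pi> + risk \<pi>'"
  unfolding risk_def inner_add_left by (rule ES_add[OF integrable_excess integrable_excess \<alpha>])

lemma risk_scale: "0 \<le> c \<Longrightarrow> risk (c *\<^sub>R \<pi>) = c * risk \<pi>"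
  unfolding risk_def inner_scaleR_left by (rule ES_scale[OF integrable_excess \<alpha>])

lemma risk_zero: "risk 0 = 0"
  using risk_scale[of 0 0] by simp

text \<open>The constant density 1 is admissible because \<open>1 / \<alpha>\<close> exceeds
  1.\<close>

lemma risk_ge_mean: "- (\<pi> \<bullet> expectation R) \<le> risk \<pi>"
  using ES_ge_density[OF integrable_excess \<alpha>, of "\<lambda>_. 1" \<pi>] \<alpha>
  by (simp add: risk_def expectation_excess prob_space)

lemma density_imp_risk_nonneg:
  assumes "Z \<in> borel_measurable M" "expectation Z = 1"
    and "AE \<omega> in M. 0 \<le> Z \<omega> \<and> Z \<omega> \<le> 1 / \<alpha>"
    and "expectation (\<lambda>\<omega>. Z \<omega> * (\<pi> \<bullet> R \<omega>)) = 0"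
  shows "0 \<le> risk \<pi>"
  using ES_ge_density[OF integrable_excess \<alpha> assms(1-3), of \<pi>] assms(4) by (simp add: risk_def)

text \<open>With nonpositive risk the dual bound at \<open>Z\<close> would be attained, so the
  excess return would be constant and equal to its mean 0 under \<open>Z\<close>, against
  nonredundancy.\<close>

lemma density_imp_risk_pos:
  assumes "Z \<in> borel_measurable M" "expectation Z = 1"
    and strict: "AE \<omega> in M. 0 < Z \<omega> \<and> Z \<omega> < 1 / \<alpha>"
    and "expectation (\<lambda>\<omega>. Z \<omega> * (\<pi> \<bullet> R \<omega>)) = 0" and "\<pi> \<noteq> 0"
  shows "0 < risk \<pi>"
proof (rule ccontr)
  assume "\<not> 0 < risk \<pi>"
  moreover have "AE \<omega> in M. 0 \<le> Z \<omega> \<and> Z \<omega> \<le> 1 / \<alpha>"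
    using strict by eventually_elim auto
  ultimately have "AE \<omega> in M. \<pi> \<bullet> R \<omega> = 0"
    using ES_eq_density_imp_const[OF integrable_excess \<alpha> assms(1,2) _ strict, of \<pi>] assms(4)
    by (simp add: risk_def)
  with nonredundant \<open>\<pi> \<noteq> 0\<close> show False by blast
qed

text \<open>The density 1 lies strictly between 0 and \<open>1 / \<alpha>\<close>.\<close>

lemma zero_mean_imp_risk_pos:
  assumes "\<pi> \<bullet> expectation R = 0" "\<pi> \<noteq> 0"
  shows "0 < risk \<pi>"
  using density_imp_risk_pos[of "\<lambda>_. 1" \<pi>] assms \<alpha>
  by (simp add: prob_space expectation_excess)

lemma risk_nonpos_imp_mean_pos:
  assumes "risk \<pi> \<le> 0" "\<pi> \<noteq> 0"
  shows "0 < \<pi> \<bullet> expectation R"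
  using risk_ge_mean[of \<pi>] zero_mean_imp_risk_pos[of \<pi>] assms by linarith

lemma continuous_on_risk: "continuous_on UNIV risk"
  by (rule sublinear_imp_continuous_on[OF risk_add risk_scale])

text \<open>Risk is coercive on the zero-mean hyperplane, and translation carries this to the level
  \<open>\<nu>\<close>. Sublevel sets there are compact, so a minimiser \<open>p\<close> exists, and
  the optimal set is the sublevel set at \<open>risk p\<close>.\<close>

lemma optimal_portfolios:
  fixes \<nu> :: real
  defines "opt \<equiv> {\<pi>. \<pi> \<bullet> expectation R = \<nu> \<and>
    (\<forall>\<pi>'. \<pi>' \<bullet> expectation R = \<nu> \<longrightarrow> risk \<pi> \<le> risk \<pi>')}"
  shows "opt \<noteq> {}" "compact opt" "convex opt"
proof -
  let ?\<mu> = "expectation R"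
  let ?H = "\<lambda>\<nu>. {\<pi>. \<pi> \<bullet> ?\<mu> = \<nu>}"
  have closed_H: "closed (?H t)" for t
    using closed_hyperplane[of ?\<mu> t] by (simp add: inner_commute)
  have convex_H: "convex (?H t)" for t
    using convex_hyperplane[of ?\<mu> t] by (simp add: inner_commute)
  have "\<exists>c>0. \<forall>\<pi>\<in>?H 0. c * norm \<pi> \<le> risk \<pi>"
    by (rule sublinear_pos_imp_coercive[OF risk_add risk_scale])
       (auto simp: closed_H zero_mean_imp_risk_pos)
  then obtain c where c: "c > 0" "\<And>\<pi>. \<pi> \<bullet> ?\<mu> = 0 \<Longrightarrow> c * norm \<pi> \<le> risk \<pi>" by auto
  \<comment> \<open>A base point of the hyperplane, chosen along the mean vector; subtracting it
    leads back to mean zero.\<close>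
  define \<pi>\<^sub>1 where "\<pi>\<^sub>1 = (\<nu> / (?\<mu> \<bullet> ?\<mu>)) *\<^sub>R ?\<mu>"
  have \<pi>1: "\<pi>\<^sub>1 \<bullet> ?\<mu> = \<nu>" using mean_nonzero by (simp add: \<pi>\<^sub>1_def)
  let ?L = "\<lambda>k. {\<pi> \<in> ?H \<nu>. risk \<pi> \<le> k}"
  have compact_L: "compact (?L k)" for k
    unfolding compact_eq_bounded_closed
  proof
    have "norm \<pi> \<le> (k + risk (- \<pi>\<^sub>1)) / c + norm \<pi>\<^sub>1" if "\<pi> \<in> ?L k" for \<pi>
    proof -
      have "c * norm (\<pi> - \<pi>\<^sub>1) \<le> risk (\<pi> + - \<pi>\<^sub>1)"
        using c(2)[of "\<pi> - \<pi>\<^sub>1"] that \<pi>1 by (simp add: inner_diff_left)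
      also have "\<dots> \<le> k + risk (- \<pi>\<^sub>1)" using risk_add[of \<pi> "- \<pi>\<^sub>1"] that by simp
      finally have "norm (\<pi> - \<pi>\<^sub>1) \<le> (k + risk (- \<pi>\<^sub>1)) / c" using c(1) by (simp add: field_simps)
      then show ?thesis using norm_triangle_sub[of \<pi> \<pi>\<^sub>1] by linarith
    qed
    then show "bounded (?L k)" by (rule boundedI)
    have "closed {\<pi>. risk \<pi> \<le> k}"
      by (rule closed_Collect_le[OF continuous_on_risk continuous_on_const])
    then have "closed (?H \<nu> \<inter> {\<pi>. risk \<pi> \<le> k})" by (intro closed_Int closed_H)
    then show "closed (?L k)" by (simp add: Int_def)
  qed
  have "?L (risk \<pi>\<^sub>1) \<noteq> {}" using \<pi>1 by auto
  then obtain p where p: "p \<in> ?L (risk \<pi>\<^sub>1)" "\<forall>y\<in>?L (risk \<pi>\<^sub>1). risk p \<le> risk y"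
    using continuous_attains_inf[OF compact_L _ continuous_on_subset[OF continuous_on_risk subset_UNIV]]
    by meson
  \<comment> \<open>Portfolios outside the sublevel set of \<open>\<pi>\<^sub>1\<close> have larger
    risk than \<open>\<pi>\<^sub>1\<close>, hence than \<open>p\<close>.\<close>
  have p_min: "risk p \<le> risk \<pi>" if "\<pi> \<bullet> ?\<mu> = \<nu>" for \<pi>
    using p that by (cases "risk \<pi> \<le> risk \<pi>\<^sub>1") auto
  have opt: "opt = ?L (risk p)"
    using p p_min unfolding opt_def by (auto intro: order_trans)
  show "opt \<noteq> {}" unfolding opt using p by auto
  show "compact opt" unfolding opt by (rule compact_L)
  have "convex {\<pi>. risk \<pi> \<le> risk p}"
  proof (rule convexI)
    fix x y and u v :: real
    assume *: "x \<in> {\<pi>. risk \<pi> \<le> risk p}" "y \<in> {\<pi>. risk \<pi> \<le> risk p}" "0 \<le> u" "0 \<le> v" "u + v = 1"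
    have "risk (u *\<^sub>R x + v *\<^sub>R y) \<le> u * risk x + v * risk y"
      using risk_add[of "u *\<^sub>R x" "v *\<^sub>R y"] * by (simp add: risk_scale)
    also have "\<dots> \<le> risk p" using * by (intro convex_bound_le) auto
    finally show "u *\<^sub>R x + v *\<^sub>R y \<in> {\<pi>. risk \<pi> \<le> risk p}" by simp
  qed
  then have "convex (?H \<nu> \<inter> {\<pi>. risk \<pi> \<le> risk p})" by (intro convex_Int convex_H)
  then show "convex opt" unfolding opt by (simp add: Int_def)
qed

text \<open>Lifts the objective to the pair of threshold and portfolio, in the shape that
  \<open>not_in_density_integrals\<close> produces for \<open>z = (1, 0)\<close>,
  \<open>a = 0\<close> and \<open>b = 1 / \<alpha>\<close>.\<close>

lemma RU_excess: "RU M \<alpha> m (\<lambda>\<omega>. \<pi> \<bullet> R \<omega>) =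
    (m, \<pi>) \<bullet> (1, 0) + expectation (\<lambda>\<omega>. max 0 (- ((m, \<pi>) \<bullet> (1, R \<omega>)))) / \<alpha>"
  by (simp add: RU_def)

lemma integrable_one_R: "integrable M (\<lambda>\<omega>. (1::real, R \<omega>))"
proof -
  have "integrable M (\<lambda>\<omega>. (1::real, 0::'v) + (0, R \<omega>))"
    using R by (intro Bochner_Integration.integrable_add integrable_bounded_linear[OF bounded_linear_Pair])
      (auto intro: bounded_linear_zero bounded_linear_ident)
  then show ?thesis by simp
qed

text \<open>The first coordinate of the integral is the total mass of \<open>Z\<close>, the second
  collects the prices of the excess returns.\<close>

lemma density_of_mem_density_integrals:
  assumes "(1, 0) \<in> density_integrals M a b (\<lambda>\<omega>. (1::real, R \<omega>))"
  obtains Z where "Z \<in> borel_measurable M" "\<And>\<omega>. a \<le> Z \<omega> \<and> Z \<omega> \<le> b"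
    "expectation Z = 1" "\<And>\<pi>. expectation (\<lambda>\<omega>. Z \<omega> * (\<pi> \<bullet> R \<omega>)) = 0"
proof -
  obtain Z where Z: "Z \<in> borel_measurable M" "\<And>\<omega>. a \<le> Z \<omega> \<and> Z \<omega> \<le> b"
    and eq: "(1, 0) = expectation (\<lambda>\<omega>. Z \<omega> *\<^sub>R (1::real, R \<omega>))"
    using assms by (auto simp: density_integrals_def)
  have "\<bar>Z \<omega>\<bar> \<le> max \<bar>a\<bar> \<bar>b\<bar>" for \<omega> using Z(2)[of \<omega>] by auto
  then have int: "integrable M (\<lambda>\<omega>. Z \<omega> *\<^sub>R (1::real, R \<omega>))"
    by (intro integrable_bounded_density[OF integrable_one_R Z(1)]) (rule AE_I2)
  have inner: "expectation (\<lambda>\<omega>. Z \<omega> * (v \<bullet> (1, R \<omega>))) = v \<bullet> (1, 0)" for v :: "real \<times> 'v"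
  proof -
    have "expectation (\<lambda>\<omega>. v \<bullet> (Z \<omega> *\<^sub>R (1::real, R \<omega>))) = v \<bullet> (1, 0)"
      using int unfolding eq by (intro integral_inner_right) auto
    then show ?thesis by (simp only: inner_scaleR_right)
  qed
  show thesis
    using inner[of "(1, 0)"] inner[of "(0, \<pi>)" for \<pi>] by (intro that[OF Z]) auto
qed

text \<open>Otherwise a separating vector is a pair of threshold and portfolio with negative
  objective, and the objective bounds the risk from above.\<close>

lemma risk_nonneg_imp_density:
  assumes "\<And>\<pi>. 0 \<le> risk \<pi>"
  obtains Z where "Z \<in> borel_measurable M" "\<And>\<omega>. 0 \<le> Z \<omega> \<and> Z \<omega> \<le> 1 / \<alpha>"
    "expectation Z = 1" "\<And>\<pi>. expectation (\<lambda>\<omega>. Z \<omega> * (\<pi> \<bullet> R \<omega>)) = 0"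
proof -
  have "(1, 0) \<in> density_integrals M 0 (1 / \<alpha>) (\<lambda>\<omega>. (1::real, R \<omega>))"
  proof (rule ccontr)
    assume notin: "\<not> ?thesis"
    have le: "0 \<le> 1 / \<alpha>" using \<alpha> by simp
    obtain v where "v \<noteq> 0" and v: "v \<bullet> (1, 0) +
        expectation (\<lambda>\<omega>. 1 / \<alpha> * max 0 (- (v \<bullet> (1::real, R \<omega>)))
          - 0 * max 0 (v \<bullet> (1, R \<omega>))) < 0"
      by (rule not_in_density_integrals[OF integrable_one_R le notin])
    have "RU M \<alpha> (fst v) (\<lambda>\<omega>. snd v \<bullet> R \<omega>) < 0"
      unfolding RU_excess using v by (simp del: inner_Pair)
    then show False
      using ES_le_RU[OF integrable_excess \<alpha>, of "snd v" "fst v"] assms[of "snd v"]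
      by (simp add: risk_def)
  qed
  then show thesis by (rule density_of_mem_density_integrals) (rule that)
qed

text \<open>Positive risk makes the objective \<open>G\<close> positive on nonzero pairs, hence
  coercive. Narrowing the density bounds by \<open>\<delta>\<close> perturbs the separating
  inequality by at most \<open>\<delta> * K * norm v\<close>, which coercivity absorbs.\<close>

lemma risk_pos_imp_density:
  assumes pos: "\<And>\<pi>. \<pi> \<noteq> 0 \<Longrightarrow> 0 < risk \<pi>"
  obtains Z \<delta> where "0 < \<delta>" "Z \<in> borel_measurable M" "\<And>\<omega>. \<delta> \<le> Z \<omega> \<and> Z \<omega> \<le> 1 / \<alpha> - \<delta>"
    "expectation Z = 1" "\<And>\<pi>. expectation (\<lambda>\<omega>. Z \<omega> * (\<pi> \<bullet> R \<omega>)) = 0"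
proof -
  let ?Y = "\<lambda>\<omega>. (1::real, R \<omega>)"
  define G where "G v = RU M \<alpha> (fst v) (\<lambda>\<omega>. snd v \<bullet> R \<omega>)" for v
  have G_eq: "G v = v \<bullet> (1, 0) + expectation (\<lambda>\<omega>. max 0 (- (v \<bullet> ?Y \<omega>))) / \<alpha>" for v
    unfolding G_def RU_excess by simp
  have "G (v + w) \<le> G v + G w" for v w
    unfolding G_def fst_add snd_add inner_add_left
    by (rule RU_add[OF integrable_excess integrable_excess \<alpha>(1)])
  moreover have "G (c *\<^sub>R v) = c * G v" if "0 \<le> c" for c v
    unfolding G_def fst_scaleR snd_scaleR inner_scaleR_left real_scaleR_def by (rule RU_scale[OF that])
  moreover have "0 < G v" if "v \<noteq> 0" for v
  proof (cases "snd v = 0")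
    case False
    then show ?thesis
      using ES_le_RU[OF integrable_excess \<alpha>, of "snd v" "fst v"] pos[of "snd v"]
      by (simp add: risk_def G_def)
  next
    case True
    then have "fst v \<noteq> 0" using that by (simp add: prod_eq_iff)
    \<comment> \<open>With zero portfolio only a constant remains; for negative \<open>x\<close> the
      sign comes from \<open>1 / \<alpha> > 1\<close>.\<close>
    moreover have "x + max 0 (- x) / \<alpha> > 0" if "x \<noteq> 0" for x :: real
      using that \<alpha> by (cases "x > 0") (auto simp: max_def field_simps mult_less_cancel_right2)
    ultimately show ?thesis using True by (simp add: G_def RU_def prob_space)
  qed
  ultimately obtain c where c: "c > 0" "\<And>v. c * norm v \<le> G v"
    using sublinear_pos_imp_coercive[of G UNIV] by auto
  define K where "K = expectation (\<lambda>\<omega>. norm (?Y \<omega>))"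
  have K: "0 \<le> K" unfolding K_def by simp
  \<comment> \<open>The first bound keeps the interval of admissible densities nonempty, the second
    gives \<open>\<delta> * K < c\<close>; adding 1 avoids a zero denominator.\<close>
  define \<delta> where "\<delta> = min (1 / (2 * \<alpha>)) (c / (K + 1))"
  have \<delta>: "0 < \<delta>" using \<alpha> c K by (simp add: \<delta>_def)
  have \<delta>_le: "\<delta> \<le> 1 / \<alpha> - \<delta>" using \<alpha> by (simp add: \<delta>_def min_def field_simps)
  have \<delta>K: "\<delta> * K < c"
  proof -
    have "\<delta> * K \<le> c / (K + 1) * K" using K by (intro mult_right_mono) (auto simp: \<delta>_def)
    also have "\<dots> < c" using c K by (simp add: field_simps)
    finally show ?thesis .
  qed
  have "(1, 0) \<in> density_integrals M \<delta> (1 / \<alpha> - \<delta>) ?Y"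
  proof (rule ccontr)
    assume notin: "\<not> ?thesis"
    obtain v where "v \<noteq> 0" and v: "v \<bullet> (1, 0) + expectation (\<lambda>\<omega>. (1 / \<alpha> - \<delta>) * max 0 (- (v \<bullet> ?Y \<omega>))
        - \<delta> * max 0 (v \<bullet> ?Y \<omega>)) < 0"
      by (rule not_in_density_integrals[OF integrable_one_R \<delta>_le notin])
    have iv: "integrable M (\<lambda>\<omega>. v \<bullet> ?Y \<omega>)" by (intro integrable_inner_right integrable_one_R)
    \<comment> \<open>The corrections on the positive and on the negative part combine into one
      absolute value.\<close>
    have "expectation (\<lambda>\<omega>. (1 / \<alpha> - \<delta>) * max 0 (- (v \<bullet> ?Y \<omega>)) - \<delta> * max 0 (v \<bullet> ?Y \<omega>))
        = expectation (\<lambda>\<omega>. max 0 (- (v \<bullet> ?Y \<omega>)) / \<alpha> - \<delta> * \<bar>v \<bullet> ?Y \<omega>\<bar>)"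
      by (intro Bochner_Integration.integral_cong refl) (auto simp: max_def field_simps)
    also have "\<dots> = expectation (\<lambda>\<omega>. max 0 (- (v \<bullet> ?Y \<omega>))) / \<alpha> - \<delta> * expectation (\<lambda>\<omega>. \<bar>v \<bullet> ?Y \<omega>\<bar>)"
      using iv by (subst Bochner_Integration.integral_diff) (auto simp del: inner_Pair)
    finally have "G v < \<delta> * expectation (\<lambda>\<omega>. \<bar>v \<bullet> ?Y \<omega>\<bar>)"
      using v unfolding G_eq by linarith
    also have "\<dots> \<le> \<delta> * (norm v * K)"
    proof (intro mult_left_mono)
      have "expectation (\<lambda>\<omega>. \<bar>v \<bullet> ?Y \<omega>\<bar>) \<le> expectation (\<lambda>\<omega>. norm v * norm (?Y \<omega>))"
        using iv integrable_one_R by (intro integral_mono) (auto intro: Cauchy_Schwarz_ineq2 simp del: inner_Pair)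
      then show "expectation (\<lambda>\<omega>. \<bar>v \<bullet> ?Y \<omega>\<bar>) \<le> norm v * K" by (simp add: K_def)
    qed (use \<delta> in simp)
    also have "\<dots> \<le> c * norm v" using mult_right_mono[OF less_imp_le[OF \<delta>K], of "norm v"]
      by (simp add: mult.assoc mult.commute[of K])
    finally show False using c(2)[of v] by simp
  qed
  then show thesis by (rule density_of_mem_density_integrals) (rule that[OF \<delta>])
qed

text \<open>A portfolio of negative risk has positive mean, so adding it to any portfolio improves
  both criteria by subadditivity. Conversely, improve on the zero portfolio, whose risk is
  0.\<close>

lemma strong_arbitrage_iff:
  "(\<forall>\<pi>. \<exists>\<pi>'. \<pi>' \<bullet> expectation R > \<pi> \<bullet> expectation R \<and> risk \<pi>' < risk \<pi>) \<longleftrightarrow> (\<exists>\<pi>. risk \<pi> < 0)"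
proof
  assume "\<forall>\<pi>. \<exists>\<pi>'. \<pi>' \<bullet> expectation R > \<pi> \<bullet> expectation R \<and> risk \<pi>' < risk \<pi>"
  then show "\<exists>\<pi>. risk \<pi> < 0" using risk_zero by metis
next
  assume "\<exists>\<pi>. risk \<pi> < 0"
  then obtain p where p: "risk p < 0" by blast
  then have "0 < p \<bullet> expectation R" using risk_ge_mean[of p] by linarith
  then have "(\<pi> + p) \<bullet> expectation R > \<pi> \<bullet> expectation R \<and> risk (\<pi> + p) < risk \<pi>" for \<pi>
    using p risk_add[of \<pi> p] by (simp add: inner_add_left)
  then show "\<forall>\<pi>. \<exists>\<pi>'. \<pi>' \<bullet> expectation R > \<pi> \<bullet> expectation R \<and> risk \<pi>' < risk \<pi>" by blast
qed

text \<open>If all nonzero portfolios carry positive risk, the zero portfolio is efficient, being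
  alone at nonpositive risk. Otherwise a nonzero \<open>p\<close> of nonpositive risk has positive
  mean, and adding it dominates any candidate.\<close>

lemma efficient_exists_iff:
  "(\<exists>\<pi>. 0 \<le> \<pi> \<bullet> expectation R \<and> \<not> (\<exists>\<pi>'. \<pi>' \<bullet> expectation R \<ge> \<pi> \<bullet> expectation R \<and> risk \<pi>' \<le> risk \<pi> \<and>
      (\<pi>' \<bullet> expectation R > \<pi> \<bullet> expectation R \<or> risk \<pi>' < risk \<pi>))) \<longleftrightarrow> (\<forall>\<pi>. \<pi> \<noteq> 0 \<longrightarrow> 0 < risk \<pi>)"
    (is "(\<exists>\<pi>. ?eff \<pi>) \<longleftrightarrow> _")
proof
  assume pos: "\<forall>\<pi>. \<pi> \<noteq> 0 \<longrightarrow> 0 < risk \<pi>"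
  then have zero: "\<pi> = 0" if "risk \<pi> \<le> 0" for \<pi> using that not_less by blast
  have "?eff 0" by (auto simp: risk_zero dest!: zero)
  then show "\<exists>\<pi>. ?eff \<pi>" by blast
next
  assume "\<exists>\<pi>. ?eff \<pi>"
  then obtain \<pi> where \<pi>: "?eff \<pi>" by blast
  show "\<forall>\<pi>. \<pi> \<noteq> 0 \<longrightarrow> 0 < risk \<pi>"
  proof (intro allI impI, rule ccontr)
    fix p :: 'v assume p: "p \<noteq> 0" "\<not> 0 < risk p"
    then have "0 < p \<bullet> expectation R" using risk_nonpos_imp_mean_pos by simp
    then have "(\<pi> + p) \<bullet> expectation R > \<pi> \<bullet> expectation R" by (simp add: inner_add_left)
    moreover have "risk (\<pi> + p) \<le> risk \<pi>" using risk_add[of \<pi> p] p by simp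
    ultimately show False using \<pi> by (meson less_imp_le)
  qed
qed

end

section \<open>Transfer to the concrete market\<close>

lemma AE_le_of_Linf_norm_le:
  assumes "Linf_norm M Z \<le> ereal c"
  shows "AE \<omega> in M. \<bar>Z \<omega>\<bar> \<le> c"
  using esssup_AE[of "\<lambda>\<omega>. ereal \<bar>Z \<omega>\<bar>" M]
proof eventually_elim
  case (elim \<omega>)
  then have "ereal \<bar>Z \<omega>\<bar> \<le> ereal c" using assms unfolding Linf_norm_def by (rule order_trans)
  then show ?case by simp
qed

lemma AE_less_of_Linf_norm_less:
  assumes "Linf_norm M Z < ereal c"
  shows "AE \<omega> in M. \<bar>Z \<omega>\<bar> < c"
  using esssup_AE[of "\<lambda>\<omega>. ereal \<bar>Z \<omega>\<bar>" M]
proof eventually_elim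
  case (elim \<omega>)
  then have "ereal \<bar>Z \<omega>\<bar> < ereal c" using assms unfolding Linf_norm_def by (rule le_less_trans)
  then show ?case by simp
qed

lemma Linf_norm_le:
  assumes "Z \<in> borel_measurable M" "\<And>\<omega>. \<bar>Z \<omega>\<bar> \<le> c"
  shows "Linf_norm M Z \<le> ereal c"
  unfolding Linf_norm_def using assms by (intro esssup_I) auto

definition excess_vector :: "real \<Rightarrow> real^'d \<Rightarrow> ('a \<Rightarrow> real^'d) \<Rightarrow> 'a \<Rightarrow> real^'d" where
  "excess_vector r S0 S1 \<omega> = (\<chi> i. ret S0 S1 i \<omega> - r)"

lemma excess_conv_inner: "excess r S0 S1 \<pi> = (\<lambda>\<omega>. \<pi> \<bullet> excess_vector r S0 S1 \<omega>)"
  by (simp add: fun_eq_iff excess_def excess_vector_def inner_vec_def)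

text \<open>The main point is nonredundancy: a portfolio with null excess return, financed at the
  riskless rate, is a zero-cost position in all assets with null payoff.\<close>

lemma ES_market_excess_vector:
  fixes S0 :: "real^'d"
  assumes market: "market M r S0 S1" and \<alpha>: "0 < \<alpha>" "\<alpha> < 1"
  shows "ES_market M (excess_vector r S0 S1) \<alpha>"
proof -
  let ?R = "excess_vector r S0 S1"
  interpret prob_space M using market by (simp add: market_def)
  have S0: "S0 $ i \<noteq> 0" for i using market by (simp add: market_def less_imp_neq[symmetric])
  have ret: "integrable M (ret S0 S1 i)" for i using market by (simp add: market_def)
  have nonred: "\<theta> = 0" if "\<theta>0 + (\<Sum>i\<in>UNIV. \<theta> $ i * S0 $ i) = 0"
    "AE \<omega> in M. \<theta>0 * (1 + r) + (\<Sum>i\<in>UNIV. \<theta> $ i * S1 \<omega> $ i) = 0" for \<theta>0 \<theta>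
    using market that unfolding market_def by blast
  have "?R = (\<lambda>\<omega>. \<Sum>i\<in>UNIV. (ret S0 S1 i \<omega> - r) *\<^sub>R axis i 1)"
    by (simp add: fun_eq_iff excess_vector_def vec_eq_iff axis_def if_distrib cong: if_cong)
  then have R: "integrable M ?R" using ret by simp
  show ?thesis
  proof
    show "integrable M ?R" "0 < \<alpha>" "\<alpha> < 1" by fact+
  next
    fix \<pi> assume zero: "AE \<omega> in M. \<pi> \<bullet> ?R \<omega> = 0"
    \<comment> \<open>From invested amounts to numbers of shares; \<open>\<theta>0\<close> finances
      the position, so that its initial cost is 0.\<close>
    define \<theta> where "\<theta> = (\<chi> i. \<pi> $ i / S0 $ i)"
    define \<theta>0 where "\<theta>0 = - (\<Sum>i\<in>UNIV. \<pi> $ i)"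
    have "\<theta>0 + (\<Sum>i\<in>UNIV. \<theta> $ i * S0 $ i) = 0"
      using S0 by (simp add: \<theta>_def \<theta>0_def)
    moreover have "\<theta>0 * (1 + r) + (\<Sum>i\<in>UNIV. \<theta> $ i * S1 \<omega> $ i) = \<pi> \<bullet> ?R \<omega>" for \<omega>
    proof -
      have "\<pi> \<bullet> ?R \<omega> = (\<Sum>i\<in>UNIV. \<theta> $ i * S1 \<omega> $ i - \<pi> $ i * (1 + r))"
        unfolding excess_vector_def inner_vec_def ret_def \<theta>_def
        using S0 by (intro sum.cong) (auto simp: field_simps)
      then show ?thesis
        by (simp add: sum_subtractf \<theta>0_def sum_distrib_right)
    qed
    ultimately have "\<theta> = 0" using zero by (intro nonred[of \<theta>0]) simp_all
    then show "\<pi> = 0" using S0 by (auto simp: \<theta>_def vec_eq_iff)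
  next
    obtain i where i: "expectation (ret S0 S1 i) \<noteq> r" using market by (auto simp: market_def)
    have "axis i 1 \<bullet> expectation ?R = expectation (\<lambda>\<omega>. axis i 1 \<bullet> ?R \<omega>)"
      using R by (intro integral_inner_right[symmetric]) auto
    also have "\<dots> = expectation (\<lambda>\<omega>. ret S0 S1 i \<omega> - r)"
      by (simp add: excess_vector_def inner_axis')
    also have "\<dots> \<noteq> 0" using ret i by (simp add: prob_space)
    finally show "expectation ?R \<noteq> 0" by auto
  qed
qed

lemma densM_expectation_zero:
  assumes "Z \<in> densM M r S0 S1"
  shows "(\<integral>\<omega>. Z \<omega> * (\<pi> \<bullet> excess_vector r S0 S1 \<omega>) \<partial>M) = 0"
proof -
  have "(\<integral>\<omega>. Z \<omega> * (\<pi> \<bullet> excess_vector r S0 S1 \<omega>) \<partial>M)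
      = (\<integral>\<omega>. (\<Sum>i\<in>UNIV. \<pi> $ i * (Z \<omega> * (ret S0 S1 i \<omega> - r))) \<partial>M)"
    by (simp add: excess_vector_def inner_vec_def sum_distrib_left mult.left_commute)
  also have "\<dots> = (\<Sum>i\<in>UNIV. \<integral>\<omega>. \<pi> $ i * (Z \<omega> * (ret S0 S1 i \<omega> - r)) \<partial>M)"
    using assms by (intro Bochner_Integration.integral_sum) (auto simp: densM_def)
  also have "\<dots> = 0" using assms by (auto simp: densM_def)
  finally show ?thesis .
qed

text \<open>Boundedness of \<open>Z\<close> supplies the integrability conditions of
  \<open>densM\<close>; unit vectors recover the price of each single excess return.\<close>

lemma (in prob_space) densM_I:
  assumes ret: "\<And>i. integrable M (ret S0 S1 i)"
    and Z: "Z \<in> borel_measurable M" "\<And>\<omega>. 0 \<le> Z \<omega>" "\<And>\<omega>. Z \<omega> \<le> c" "expectation Z = 1"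
      "\<And>\<pi>. expectation (\<lambda>\<omega>. Z \<omega> * (\<pi> \<bullet> excess_vector r S0 S1 \<omega>)) = 0"
  shows "Z \<in> densM M r S0 S1"
proof -
  have bound: "AE \<omega> in M. \<bar>Z \<omega>\<bar> \<le> c" using Z by simp
  have "integrable M (\<lambda>\<omega>. Z \<omega> *\<^sub>R (1::real))"
    by (rule integrable_bounded_density[OF _ Z(1) bound]) simp
  moreover have "integrable M (\<lambda>\<omega>. Z \<omega> *\<^sub>R (ret S0 S1 i \<omega> - r))" for i
    using ret by (intro integrable_bounded_density[OF _ Z(1) bound]) simp
  moreover have "expectation (\<lambda>\<omega>. Z \<omega> * (ret S0 S1 i \<omega> - r)) = 0" for i
    using Z(5)[of "axis i 1"] by (simp add: excess_vector_def inner_axis')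
  ultimately show ?thesis
    using Z(2,4) by (auto simp: densM_def densD_def)
qed

theorem theorem5p4:
  fixes M :: "'a measure" and r :: real and S0 :: "real^'d" and S1 :: "'a \<Rightarrow> real^'d"
    and \<alpha> :: real
  assumes "market M r S0 S1"
    and "0 < \<alpha>" and "\<alpha> < 1"
  shows "(\<forall>\<nu>\<ge>0. Pi_opt M (ES M \<alpha>) r S0 S1 \<nu> \<noteq> {} \<and>
                 compact (Pi_opt M (ES M \<alpha>) r S0 S1 \<nu>) \<and>
                 convex (Pi_opt M (ES M \<alpha>) r S0 S1 \<nu>))
       \<and> (\<not> strong_rho_arbitrage M (ES M \<alpha>) r S0 S1 \<longleftrightarrow>
            (\<exists>Z\<in>densM M r S0 S1. Linf_norm M Z \<le> ereal (1 / \<alpha>)))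
       \<and> (\<not> rho_arbitrage M (ES M \<alpha>) r S0 S1 \<longleftrightarrow>
            (\<exists>Z\<in>densP M r S0 S1. Linf_norm M Z < ereal (1 / \<alpha>)))"
proof -
  define R where "R = excess_vector r S0 S1"
  interpret ES_market M R \<alpha>
    unfolding R_def by (rule ES_market_excess_vector[OF assms])
  have ret: "integrable M (ret S0 S1 i)" for i using assms(1) by (simp add: market_def)
  have risk: "ES M \<alpha> (excess r S0 S1 \<pi>) = risk \<pi>" for \<pi>
    unfolding excess_conv_inner R_def[symmetric] risk_def ..
  have mean: "(\<integral>\<omega>. excess r S0 S1 \<pi> \<omega> \<partial>M) = \<pi> \<bullet> expectation R" for \<pi>
    unfolding excess_conv_inner R_def[symmetric] by (rule expectation_excess)
  have opt: "Pi_opt M (ES M \<alpha>) r S0 S1 \<nu> = {\<pi>. \<pi> \<bullet> expectation R = \<nu> \<and>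
      (\<forall>\<pi>'. \<pi>' \<bullet> expectation R = \<nu> \<longrightarrow> risk \<pi> \<le> risk \<pi>')}" for \<nu>
    by (auto simp: Pi_opt_def Pi_nu_def risk mean)
  have "\<not> strong_rho_arbitrage M (ES M \<alpha>) r S0 S1 \<longleftrightarrow> (\<forall>\<pi>. 0 \<le> risk \<pi>)"
    unfolding strong_rho_arbitrage_def risk mean strong_arbitrage_iff by (auto simp: not_less)
  also have "\<dots> \<longleftrightarrow> (\<exists>Z\<in>densM M r S0 S1. Linf_norm M Z \<le> ereal (1 / \<alpha>))"
  proof
    assume "\<forall>\<pi>. 0 \<le> risk \<pi>"
    then have nonneg: "0 \<le> risk \<pi>" for \<pi> by blast
    obtain Z where Z: "Z \<in> borel_measurable M" "\<And>\<omega>. 0 \<le> Z \<omega> \<and> Z \<omega> \<le> 1 / \<alpha>"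
      "expectation Z = 1" "\<And>\<pi>. expectation (\<lambda>\<omega>. Z \<omega> * (\<pi> \<bullet> R \<omega>)) = 0"
      by (rule risk_nonneg_imp_density[OF nonneg]) (rule that)
    have "Z \<in> densM M r S0 S1" using Z unfolding R_def by (intro densM_I[OF ret, of _ "1 / \<alpha>"]) auto
    moreover have "Linf_norm M Z \<le> ereal (1 / \<alpha>)" using Z by (intro Linf_norm_le) auto
    ultimately show "\<exists>Z\<in>densM M r S0 S1. Linf_norm M Z \<le> ereal (1 / \<alpha>)" by blast
  next
    assume "\<exists>Z\<in>densM M r S0 S1. Linf_norm M Z \<le> ereal (1 / \<alpha>)"
    then obtain Z where Z: "Z \<in> densM M r S0 S1" "Linf_norm M Z \<le> ereal (1 / \<alpha>)" by blast
    have pos: "AE \<omega> in M. 0 \<le> Z \<omega>" and meas: "Z \<in> borel_measurable M" "expectation Z = 1"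
      using Z(1) by (auto simp: densM_def densD_def)
    have "AE \<omega> in M. 0 \<le> Z \<omega> \<and> Z \<omega> \<le> 1 / \<alpha>"
      using pos AE_le_of_Linf_norm_le[OF Z(2)] by eventually_elim auto
    then show "\<forall>\<pi>. 0 \<le> risk \<pi>"
      using density_imp_risk_nonneg[OF meas] densM_expectation_zero[OF Z(1)] by (simp add: R_def)
  qed
  finally have a: "\<not> strong_rho_arbitrage M (ES M \<alpha>) r S0 S1 \<longleftrightarrow>
      (\<exists>Z\<in>densM M r S0 S1. Linf_norm M Z \<le> ereal (1 / \<alpha>))" .
  have "\<not> rho_arbitrage M (ES M \<alpha>) r S0 S1 \<longleftrightarrow> (\<forall>\<pi>. \<pi> \<noteq> 0 \<longrightarrow> 0 < risk \<pi>)"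
    unfolding rho_arbitrage_def efficient_def Let_def risk mean efficient_exists_iff not_not ..
  also have "\<dots> \<longleftrightarrow> (\<exists>Z\<in>densP M r S0 S1. Linf_norm M Z < ereal (1 / \<alpha>))"
  proof
    assume "\<forall>\<pi>. \<pi> \<noteq> 0 \<longrightarrow> 0 < risk \<pi>"
    then have pos: "0 < risk \<pi>" if "\<pi> \<noteq> 0" for \<pi> using that by blast
    obtain Z \<delta> where \<delta>: "0 < \<delta>" and Z: "Z \<in> borel_measurable M"
      "\<And>\<omega>. \<delta> \<le> Z \<omega> \<and> Z \<omega> \<le> 1 / \<alpha> - \<delta>"
      "expectation Z = 1" "\<And>\<pi>. expectation (\<lambda>\<omega>. Z \<omega> * (\<pi> \<bullet> R \<omega>)) = 0"
      by (rule risk_pos_imp_density, erule pos) (rule that)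
    have Z_pos: "0 < Z \<omega>" for \<omega> using Z(2)[of \<omega>] \<delta> by linarith
    then have "Z \<in> densM M r S0 S1"
      using Z unfolding R_def by (intro densM_I[OF ret, of _ "1 / \<alpha> - \<delta>"]) (auto intro: less_imp_le)
    then have "Z \<in> densP M r S0 S1" using Z_pos by (simp add: densP_def)
    \<comment> \<open>The uniform margin \<open>\<delta>\<close> keeps the essential supremum
      strictly below \<open>1 / \<alpha>\<close>; a pointwise strict bound would not
      suffice.\<close>
    moreover have "Linf_norm M Z \<le> ereal (1 / \<alpha> - \<delta>)"
      using Z Z_pos by (intro Linf_norm_le) (auto simp: abs_of_pos)
    moreover have "ereal (1 / \<alpha> - \<delta>) < ereal (1 / \<alpha>)" using \<delta> by simp
    ultimately show "\<exists>Z\<in>densP M r S0 S1. Linf_norm M Z < ereal (1 / \<alpha>)" by (meson le_less_trans)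
  next
    assume "\<exists>Z\<in>densP M r S0 S1. Linf_norm M Z < ereal (1 / \<alpha>)"
    then obtain Z where Z: "Z \<in> densM M r S0 S1" "AE \<omega> in M. 0 < Z \<omega>" "Linf_norm M Z < ereal (1 / \<alpha>)"
      by (auto simp: densP_def)
    have meas: "Z \<in> borel_measurable M" "expectation Z = 1"
      using Z(1) by (auto simp: densM_def densD_def)
    have "AE \<omega> in M. 0 < Z \<omega> \<and> Z \<omega> < 1 / \<alpha>"
      using Z(2) AE_less_of_Linf_norm_less[OF Z(3)] by eventually_elim auto
    then show "\<forall>\<pi>. \<pi> \<noteq> 0 \<longrightarrow> 0 < risk \<pi>"
      using density_imp_risk_pos[OF meas] densM_expectation_zero[OF Z(1)] by (simp add: R_def)
  qed
  finally have b: "\<not> rho_arbitrage M (ES M \<alpha>) r S0 S1 \<longleftrightarrow>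
      (\<exists>Z\<in>densP M r S0 S1. Linf_norm M Z < ereal (1 / \<alpha>))" .
  show ?thesis
    unfolding opt by (intro conjI allI impI optimal_portfolios a b)
qed

end
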